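(* Let $n \geq 2$ and let $\tau \in S_n$ be a permutation that is not an $n$-cycle. Then the subset of well-rounded lattices in the set $\mathcal{C}_n(\tau)$ of full-rank $\tau$-invariant lattices in $\mathbb{R}^n$ has positive co-dimension in $\mathcal{C}_n(\tau)$.
   Context: $S_n$ acts on $\mathbb{R}^n$ by $\tau(\boldsymbol{x}) = (x_{\tau(1)},\dots,x_{\tau(n)})^t$ for $\boldsymbol{x} = (x_1,\dots,x_n)^t$. A lattice $\Lambda \subset \mathbb{R}^n$ is $\tau$-invariant if $\tau(\Lambda) = \Lambda$; $\mathcal{C}_n(\tau)$ denotes the set of all full-rank $\tau$-invariant lattices in $\mathbb{R}^n$ (equivalently, full-rank lattices whose automorphism group contains $\tau$). For a full-rank lattice $\Lambda$ with successive minima $\lambda_1 \leq \dots \leq \lambda_n$ (where $\lambda_i$ is the least $r>0$ such that $\Lambda \cap B_n(r)$ spans a space of dimension at least $i$, $B_n(r)$ the closed Euclidean ball of radius $r$ centered at the origin), $\Lambda$ is well-rounded if $\lambda_1 = \dots = \lambda_n$. Lattices are identified with their basis matrices in $\mathrm{GL}_n(\mathbb{R})$ modulo $\mathrm{GL}_n(\mathbb{Z})$, i.e. with points of the $n^2$-dimensional space of real $n\times n$ matrices up to $\mathrm{GL}_n(\mathbb{Z})$-equivalence; dimension and co-dimension of sets of lattices are understood with respect to this identification (as sets of matrices subject to the corresponding restrictions). *)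

theory Defs
  imports "HOL-Analysis.Analysis" "HOL-Combinatorics.Cycles"
begin

section \<open>Permutation invariant lattices\<close>

definition perm_act :: "('n \<Rightarrow> 'n) \<Rightarrow> real ^ 'n \<Rightarrow> real ^ 'n" where
  "perm_act \<tau> x = (\<chi> i. x $ \<tau> i)"

text \<open>The index type \<open>'n\<close> plays the role of \<open>{1..n}\<close>, so an \<open>n\<close>-cycle is a cycle through
  all elements of \<open>'n\<close>.\<close>

definition full_cycle :: "('n::finite \<Rightarrow> 'n) \<Rightarrow> bool" where
  "full_cycle \<tau> \<longleftrightarrow> (\<exists>cs. cycle cs \<and> length cs = CARD('n) \<and> \<tau> = cycle_of_list cs)"

text \<open>The lattice spanned over the integers by the columns of \<open>B\<close>.\<close>

definition lattice_of_basis :: "real ^ 'n ^ 'n \<Rightarrow> (real ^ 'n) set" where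
  "lattice_of_basis B = {B *v z | z. \<forall>i. z $ i \<in> \<int>}"

definition full_rank_lattice :: "(real ^ 'n::finite) set \<Rightarrow> bool" where
  "full_rank_lattice \<Lambda> \<longleftrightarrow> (\<exists>B. invertible B \<and> \<Lambda> = lattice_of_basis B)"

definition invariant_lattices :: "('n::finite \<Rightarrow> 'n) \<Rightarrow> (real ^ 'n) set set" where
  "invariant_lattices \<tau> = {\<Lambda>. full_rank_lattice \<Lambda> \<and> perm_act \<tau> ` \<Lambda> = \<Lambda>}"

text \<open>\<^const>\<open>dim\<close> of a set is the dimension of its span.  For a full-rank lattice and
  \<open>1 \<le> i \<le> n\<close> the minimum exists, because bounded subsets of the lattice are finite.\<close>

definition successive_minimum :: "(real ^ 'n) set \<Rightarrow> nat \<Rightarrow> real" where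
  "successive_minimum \<Lambda> i = (LEAST r. 0 < r \<and> i \<le> dim (\<Lambda> \<inter> cball 0 r))"

definition well_rounded :: "(real ^ 'n::finite) set \<Rightarrow> bool" where
  "well_rounded \<Lambda> \<longleftrightarrow>
     (\<forall>i\<in>{1..CARD('n)}. successive_minimum \<Lambda> i = successive_minimum \<Lambda> 1)"

section \<open>Dimension of sets of lattices\<close>

text \<open>Hausdorff measure and Hausdorff dimension.  The library \<^const>\<open>diameter\<close> is
  meaningful only for bounded sets, hence the explicit boundedness condition on covers.  Since
  \<open>0 powr s = 0\<close>, the measure below is the usual one for \<open>s > 0\<close>; the case \<open>s = 0\<close> is not
  used in the definition of the dimension.\<close>

definition hausdorff_premeasure :: "real \<Rightarrow> real \<Rightarrow> 'a::metric_space set \<Rightarrow> ennreal" where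
  "hausdorff_premeasure s \<delta> A =
     (INF U \<in> {U :: nat \<Rightarrow> 'a set.
                A \<subseteq> (\<Union>i. U i) \<and> (\<forall>i. bounded (U i) \<and> diameter (U i) \<le> \<delta>)}.
        \<Sum>i. ennreal (diameter (U i) powr s))"

definition hausdorff_measure :: "real \<Rightarrow> 'a::metric_space set \<Rightarrow> ennreal" where
  "hausdorff_measure s A = (SUP \<delta>\<in>{0<..}. hausdorff_premeasure s \<delta> A)"

definition hausdorff_dim :: "'a::metric_space set \<Rightarrow> ereal" where
  "hausdorff_dim A = Inf {ereal s | s. 0 < s \<and> hausdorff_measure s A = 0}"

text \<open>Lattices are points of the space of invertible matrices modulo right multiplication by the
  countable group of integral matrices of determinant \<open>\<plusminus>1\<close>.  A set of lattices is
  therefore identified with the set of all basis matrices of its members, and its dimension is that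
  of this set in the \<open>n\<^sup>2\<close>-dimensional Euclidean space of matrices.  For a fixed permutation,
  the basis matrices of invariant lattices form a countable union of nonempty relatively open
  subsets of linear subspaces of one common dimension; Hausdorff dimension (countably stable, and
  equal to the manifold dimension on submanifolds) gives such sets their geometric dimension.\<close>

definition basis_matrices :: "(real ^ 'n::finite) set set \<Rightarrow> (real ^ 'n ^ 'n) set" where
  "basis_matrices L = {B. invertible B \<and> lattice_of_basis B \<in> L}"

definition lattice_dim :: "(real ^ 'n::finite) set set \<Rightarrow> ereal" where
  "lattice_dim L = hausdorff_dim (basis_matrices L)"

text \<open>Both dimensions lie between \<open>0\<close> and \<open>n\<^sup>2\<close>, so the difference is one of finite
  numbers.\<close>

definition lattice_codim :: "(real ^ 'n::finite) set set \<Rightarrow> (real ^ 'n) set set \<Rightarrow> ereal" where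
  "lattice_codim W L = lattice_dim L - lattice_dim W"

end

theory Submission
  imports Defs
begin

text \<open>
  Let \<open>P\<close> be the matrix of \<open>\<tau>\<close> and \<open>V\<close> the space of matrices commuting with \<open>P\<close>, of dimension
  \<open>d\<close>.  A basis matrix \<open>B\<close> of an invariant lattice satisfies \<open>P B = B M\<close> for an integral \<open>M\<close>,
  and the invertible solutions for a fixed \<open>M\<close> are the matrices \<open>C B\<^sub>0\<close> with \<open>C \<in> V\<close>, where
  \<open>B\<^sub>0\<close> is any one of them.  The choice \<open>M = P\<close>, \<open>B\<^sub>0 = 1\<close> gives dimension at least \<open>d\<close>.

  If the lattice of \<open>B = C B\<^sub>0\<close> is well-rounded, its minimal vectors \<open>B z\<close> span, and
  \<open>\<bar>C v\<bar> = \<bar>C v'\<bar>\<close> for all vectors \<open>v = B\<^sub>0 z\<close>, \<open>v' = B\<^sub>0 z'\<close> arising from them.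
  As \<open>\<tau>\<close> is not a full cycle, it preserves a proper nonempty set of indices; with \<open>u\<close>, \<open>w\<close> the
  indicator vectors of this set and of its complement, the elements \<open>1\<close> and \<open>1 \<plusminus> w u\<^sup>T\<close> of \<open>V\<close>
  show that these equations cannot all hold identically on \<open>V\<close>.  So the well-rounded basis matrices
  lie in countably many linear images of zero sets in \<open>V\<close> of nonzero quadratic forms, and such a
  zero set has Hausdorff dimension at most \<open>d - 1/2\<close>: on a grid line of mesh \<open>1/m\<close> in a
  non-isotropic direction, only \<open>O(\<surd>m)\<close> grid points have a value \<open>O(1/m)\<close>.  The true bound
  \<open>d - 1\<close> is not needed.
\<close>

section \<open>Hausdorff dimension\<close>

text \<open>Unlike \<open>hausdorff_measure\<close>, this puts no bound on the mesh. For
  \<open>s > 0\<close> it still describes measure zero, and covers can be built without controlling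
  single diameters.\<close>

definition hausdorff_null :: "real \<Rightarrow> 'a::metric_space set \<Rightarrow> bool" where
  "hausdorff_null s A \<longleftrightarrow>
     (\<forall>\<epsilon>>0. \<exists>U :: nat \<Rightarrow> 'a set. A \<subseteq> (\<Union>i. U i) \<and> (\<forall>i. bounded (U i)) \<and>
        (\<Sum>i. ennreal (diameter (U i) powr s)) < ennreal \<epsilon>)"

lemma hausdorff_nullE:
  assumes "hausdorff_null s A" and "\<epsilon> > 0"
  obtains U :: "nat \<Rightarrow> 'a::metric_space set"
  where "A \<subseteq> (\<Union>i. U i)" "\<And>i. bounded (U i)" "(\<Sum>i. ennreal (diameter (U i) powr s)) < ennreal \<epsilon>"
proof -
  have "\<exists>U :: nat \<Rightarrow> 'a set. A \<subseteq> (\<Union>i. U i) \<and> (\<forall>i. bounded (U i)) \<and>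
      (\<Sum>i. ennreal (diameter (U i) powr s)) < ennreal \<epsilon>"
    using assms unfolding hausdorff_null_def by simp
  then show thesis
    by (elim exE conjE) (rule that, simp_all)
qed

lemma powr_diameter_less:
  assumes "(\<Sum>i. ennreal (diameter (U i) powr s)) < ennreal \<epsilon>"
  shows "diameter (U i) powr s < \<epsilon>"
proof -
  have "ennreal (diameter (U i) powr s) < ennreal \<epsilon>"
    using assms by (rule ennreal_suminf_lessD)
  then show ?thesis
    by (simp add: ennreal_less_iff)
qed

text \<open>A small sum forces every single diameter to be small, so for measure zero the bound \<open>\<delta>\<close> on
  the diameters of the cover can be dropped.\<close>

lemma hausdorff_measure_eq_0_iff:
  fixes A :: "'a::metric_space set"
  assumes "s > 0"
  shows "hausdorff_measure s A = 0 \<longleftrightarrow> hausdorff_null s A"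
proof
  assume 0: "hausdorff_measure s A = 0"
  show "hausdorff_null s A"
    unfolding hausdorff_null_def
  proof (intro allI impI)
    fix \<epsilon> :: real assume "\<epsilon> > 0"
    have "hausdorff_premeasure s 1 A \<le> hausdorff_measure s A"
      unfolding hausdorff_measure_def by (rule SUP_upper) auto
    then have "hausdorff_premeasure s 1 A < ennreal \<epsilon>"
      using 0 \<open>\<epsilon> > 0\<close> by simp
    then show "\<exists>U :: nat \<Rightarrow> 'a set. A \<subseteq> (\<Union>i. U i) \<and> (\<forall>i. bounded (U i)) \<and>
        (\<Sum>i. ennreal (diameter (U i) powr s)) < ennreal \<epsilon>"
      unfolding hausdorff_premeasure_def INF_less_iff by blast
  qed
next
  assume null: "hausdorff_null s A"
  have "hausdorff_premeasure s \<delta> A \<le> 0" if "\<delta> > 0" for \<delta>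
  proof (rule ennreal_le_epsilon)
    fix e :: real assume "e > 0"
    define \<epsilon> where "\<epsilon> = min e (\<delta> powr s)"
    have "\<epsilon> > 0" using \<open>e > 0\<close> \<open>\<delta> > 0\<close> by (simp add: \<epsilon>_def)
    obtain U :: "nat \<Rightarrow> 'a set" where U: "A \<subseteq> (\<Union>i. U i)" "\<And>i. bounded (U i)"
      and small: "(\<Sum>i. ennreal (diameter (U i) powr s)) < ennreal \<epsilon>"
      by (rule hausdorff_nullE[OF null \<open>\<epsilon> > 0\<close>]) blast
    have "diameter (U i) \<le> \<delta>" for i
    proof (rule ccontr)
      assume "\<not> diameter (U i) \<le> \<delta>"
      then have "\<delta> powr s \<le> diameter (U i) powr s"
        using \<open>\<delta> > 0\<close> \<open>s > 0\<close> by (intro powr_mono2) auto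
      with powr_diameter_less[OF small, of i] show False
        by (simp add: \<epsilon>_def)
    qed
    then have "hausdorff_premeasure s \<delta> A \<le> (\<Sum>i. ennreal (diameter (U i) powr s))"
      unfolding hausdorff_premeasure_def using U by (intro INF_lower) auto
    also have "\<dots> \<le> ennreal e"
      by (rule order_trans[OF less_imp_le[OF small]]) (simp add: \<epsilon>_def ennreal_leI)
    finally show "hausdorff_premeasure s \<delta> A \<le> 0 + ennreal e" by simp
  qed
  then have "hausdorff_measure s A \<le> 0"
    unfolding hausdorff_measure_def by (intro SUP_least) auto
  then show "hausdorff_measure s A = 0" by simp
qed

section \<open>Null sets under countable unions and Lipschitz maps\<close>

lemma hausdorff_null_subset:
  "hausdorff_null s B \<Longrightarrow> A \<subseteq> B \<Longrightarrow> hausdorff_null s A"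
  unfolding hausdorff_null_def by (metis subset_trans)

text \<open>The budgets \<open>\<epsilon>/2 * (1/2)^Suc m\<close> for the members add up to
  \<open>\<epsilon>/2\<close>, which leaves room for the strict inequality.\<close>

lemma hausdorff_null_UN_nat:
  fixes A :: "nat \<Rightarrow> 'a::metric_space set"
  assumes "\<And>m. hausdorff_null s (A m)"
  shows "hausdorff_null s (\<Union>m. A m)"
  unfolding hausdorff_null_def
proof (intro allI impI)
  fix \<epsilon> :: real assume "\<epsilon> > 0"
  have "\<forall>m. \<exists>V :: nat \<Rightarrow> 'a set. A m \<subseteq> (\<Union>i. V i) \<and> (\<forall>i. bounded (V i)) \<and>
        (\<Sum>i. ennreal (diameter (V i) powr s)) < ennreal (\<epsilon>/2 * (1/2)^Suc m)"
  proof
    fix m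
    have "\<epsilon>/2 * (1/2)^Suc m > 0" using \<open>\<epsilon> > 0\<close> by simp
    then show "\<exists>V :: nat \<Rightarrow> 'a set. A m \<subseteq> (\<Union>i. V i) \<and> (\<forall>i. bounded (V i)) \<and>
        (\<Sum>i. ennreal (diameter (V i) powr s)) < ennreal (\<epsilon>/2 * (1/2)^Suc m)"
      using assms[of m] unfolding hausdorff_null_def by (elim allE impE)
  qed
  from choice[OF this] obtain U :: "nat \<Rightarrow> nat \<Rightarrow> 'a set"
    where *: "\<forall>m. A m \<subseteq> (\<Union>i. U m i) \<and> (\<forall>i. bounded (U m i)) \<and>
        (\<Sum>i. ennreal (diameter (U m i) powr s)) < ennreal (\<epsilon>/2 * (1/2)^Suc m)"
    by (elim exE)
  have U: "\<And>m. A m \<subseteq> (\<Union>i. U m i)" "\<And>m i. bounded (U m i)"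
    "\<And>m. (\<Sum>i. ennreal (diameter (U m i) powr s)) < ennreal (\<epsilon>/2 * (1/2)^Suc m)"
    by (rule *[THEN spec, THEN conjunct1]
        *[THEN spec, THEN conjunct2, THEN conjunct1, THEN spec]
        *[THEN spec, THEN conjunct2, THEN conjunct2])+
  \<comment> \<open>The pairing bijection turns the double sequence of covering sets into a single
    one.\<close>
  define W where "W = (\<lambda>k. case_prod U (prod_decode k))"
  have "(\<Sum>k. ennreal (diameter (W k) powr s)) =
      (\<Sum>m. \<Sum>i. ennreal (diameter (U m i) powr s))"
  proof -
    define F where "F = (\<lambda>p. ennreal (diameter (case_prod U p) powr s))"
    have "(\<Sum>i. ennreal (diameter (U m i) powr s)) = (\<Sum>i. F (m, i))" for m
      by (simp only: F_def prod.case)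
    from suminf_ennreal_2dimen[where f = F, OF this] show ?thesis
      by (simp only: F_def W_def)
  qed
  also have "\<dots> \<le> (\<Sum>m. ennreal (\<epsilon>/2 * (1/2)^Suc m))"
    by (rule suminf_le) (rule less_imp_le[OF U(3)] summableI)+
  also have "\<dots> = ennreal (\<epsilon>/2)"
  proof (rule suminf_ennreal_eq)
    show "(\<lambda>m. \<epsilon>/2 * (1/2)^Suc m) sums (\<epsilon>/2)"
      using sums_mult[OF power_half_series, of "\<epsilon>/2"] by simp
  qed (use \<open>\<epsilon> > 0\<close> in auto)
  also have "\<dots> < ennreal \<epsilon>"
    using \<open>\<epsilon> > 0\<close> by (simp add: ennreal_less_iff)
  finally have "(\<Sum>k. ennreal (diameter (W k) powr s)) < ennreal \<epsilon>" .
  moreover have "(\<Union>m. A m) \<subseteq> (\<Union>k. W k)"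
  proof
    fix x assume "x \<in> (\<Union>m. A m)"
    then obtain m i where "x \<in> U m i" using U(1) by blast
    then have "x \<in> W (prod_encode (m, i))" by (simp add: W_def)
    then show "x \<in> (\<Union>k. W k)" by blast
  qed
  moreover have "bounded (W k)" for k
    by (simp add: W_def U(2) split: prod.split)
  ultimately show "\<exists>U :: nat \<Rightarrow> 'a set. (\<Union>m. A m) \<subseteq> (\<Union>i. U i) \<and> (\<forall>i. bounded (U i)) \<and>
        (\<Sum>i. ennreal (diameter (U i) powr s)) < ennreal \<epsilon>"
    by (intro exI[of _ W] conjI allI)
qed

lemma hausdorff_null_empty: "hausdorff_null s {}"
  unfolding hausdorff_null_def by (auto intro!: exI[of _ "\<lambda>_. {}"])

lemma hausdorff_null_UN:
  assumes "countable I" and "\<And>i. i \<in> I \<Longrightarrow> hausdorff_null s (A i)"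
  shows "hausdorff_null s (\<Union>i\<in>I. A i)"
proof (cases "I = {}")
  case False
  have "hausdorff_null s (\<Union>m. A (from_nat_into I m))"
    by (intro hausdorff_null_UN_nat assms(2) from_nat_into[OF False])
  moreover have "(\<Union>i\<in>I. A i) \<subseteq> (\<Union>m. A (from_nat_into I m))"
    by (subst range_from_nat_into[OF False assms(1), symmetric]) simp
  ultimately show ?thesis
    by (rule hausdorff_null_subset)
qed (simp add: hausdorff_null_empty)

text \<open>The images of a cover form a cover whose diameters grow at most by the factor
  \<open>L\<close>, so the sum grows at most by \<open>L powr s\<close>.\<close>

lemma hausdorff_null_lipschitz_image:
  fixes f :: "'a::metric_space \<Rightarrow> 'b::real_normed_vector"
  assumes null: "hausdorff_null s A" and "s > 0" "L > 0"
    and lip: "\<And>x y. dist (f x) (f y) \<le> L * dist x y"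
  shows "hausdorff_null s (f ` A)"
  unfolding hausdorff_null_def
proof (intro allI impI)
  fix \<epsilon> :: real assume "\<epsilon> > 0"
  then have "\<epsilon> / L powr s > 0" using \<open>L > 0\<close> by simp
  then obtain U :: "nat \<Rightarrow> 'a set" where U: "A \<subseteq> (\<Union>i. U i)" "\<And>i. bounded (U i)"
      and small: "(\<Sum>i. ennreal (diameter (U i) powr s)) < ennreal (\<epsilon> / L powr s)"
    by (rule hausdorff_nullE[OF null]) blast
  have diam: "diameter (f ` U i) \<le> L * diameter (U i)" for i
  proof (rule diameter_le)
    show "f ` U i \<noteq> {} \<or> 0 \<le> L * diameter (U i)"
      using \<open>L > 0\<close> diameter_ge_0[OF U(2)] by simp
    fix x y assume "x \<in> f ` U i" "y \<in> f ` U i"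
    then obtain u v where uv: "u \<in> U i" "v \<in> U i" "x = f u" "y = f v" by blast
    then have "dist x y \<le> L * dist u v" using lip by simp
    also have "\<dots> \<le> L * diameter (U i)"
      using \<open>L > 0\<close> diameter_bounded_bound[OF U(2) uv(1,2)] by simp
    finally show "norm (x - y) \<le> L * diameter (U i)" by (simp add: dist_norm)
  qed
  have bdd: "bounded (f ` U i)" for i
  proof -
    obtain z e where *: "\<And>x. x \<in> U i \<Longrightarrow> dist z x \<le> e"
      using U(2)[of i] unfolding bounded_def by blast
    then have "dist (f z) (f x) \<le> L * e" if "x \<in> U i" for x
    proof -
      have "L * dist z x \<le> L * e" using \<open>L > 0\<close> *[OF that] by simp
      with lip[of z x] show ?thesis by simp
    qed
    then show ?thesis unfolding bounded_def by blast
  qed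
  have "(\<Sum>i. ennreal (diameter (f ` U i) powr s)) \<le>
      (\<Sum>i. ennreal (L powr s) * ennreal (diameter (U i) powr s))"
  proof (rule suminf_le)
    fix i
    have "diameter (f ` U i) powr s \<le> (L * diameter (U i)) powr s"
      using diam \<open>s > 0\<close> diameter_ge_0[OF bdd] by (intro powr_mono2) auto
    also have "\<dots> = L powr s * diameter (U i) powr s"
      using \<open>L > 0\<close> diameter_ge_0[OF U(2)] by (simp add: powr_mult)
    finally show "ennreal (diameter (f ` U i) powr s) \<le>
        ennreal (L powr s) * ennreal (diameter (U i) powr s)"
      by (simp add: ennreal_mult[symmetric] ennreal_leI)
  qed auto
  also have "\<dots> = ennreal (L powr s) * (\<Sum>i. ennreal (diameter (U i) powr s))"
    by simp
  also have "\<dots> < ennreal (L powr s) * ennreal (\<epsilon> / L powr s)"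
    using small \<open>L > 0\<close> by (intro ennreal_mult_strict_left_mono) auto
  also have "\<dots> = ennreal \<epsilon>"
    using \<open>L > 0\<close> \<open>\<epsilon> > 0\<close> by (simp add: ennreal_mult[symmetric])
  finally have "(\<Sum>i. ennreal (diameter (f ` U i) powr s)) < ennreal \<epsilon>" .
  moreover have "f ` A \<subseteq> (\<Union>i. f ` U i)" using U(1) by blast
  ultimately show "\<exists>V :: nat \<Rightarrow> 'b set. f ` A \<subseteq> (\<Union>i. V i) \<and> (\<forall>i. bounded (V i)) \<and>
        (\<Sum>i. ennreal (diameter (V i) powr s)) < ennreal \<epsilon>"
    using bdd by (intro exI[of _ "\<lambda>i. f ` U i"] conjI allI)
qed

text \<open>The free index type lets grid points index the cover.\<close>

lemma hausdorff_nullI_finite_cover: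
  fixes A :: "'a::metric_space set"
  assumes "\<And>\<epsilon>. \<epsilon> > 0 \<Longrightarrow> \<exists>(I :: 'b set) U. finite I \<and> A \<subseteq> (\<Union>i\<in>I. U i) \<and>
      (\<forall>i\<in>I. bounded (U i)) \<and> (\<Sum>i\<in>I. diameter (U i) powr s) < \<epsilon>"
  shows "hausdorff_null s A"
  unfolding hausdorff_null_def
proof (intro allI impI)
  fix \<epsilon> :: real assume "\<epsilon> > 0"
  then obtain I :: "'b set" and U where U: "finite I" "A \<subseteq> (\<Union>i\<in>I. U i)"
      "\<And>i. i \<in> I \<Longrightarrow> bounded (U i)" "(\<Sum>i\<in>I. diameter (U i) powr s) < \<epsilon>"
    using assms[OF \<open>\<epsilon> > 0\<close>] by blast
  obtain h where h: "bij_betw h {0..<card I} I"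
    using ex_bij_betw_nat_finite[OF U(1)] by blast
  \<comment> \<open>Padding with empty sets costs nothing: \<open>diameter {} = 0\<close> and
    \<open>0 powr s = 0\<close>.\<close>
  define W where "W = (\<lambda>k. if k < card I then U (h k) else {})"
  have "(\<Sum>k. ennreal (diameter (W k) powr s)) =
      (\<Sum>k\<in>{0..<card I}. ennreal (diameter (W k) powr s))"
    by (rule suminf_finite) (auto simp: W_def)
  also have "\<dots> = (\<Sum>k\<in>{0..<card I}. ennreal (diameter (U (h k)) powr s))"
    by (rule sum.cong) (auto simp: W_def)
  also have "\<dots> = (\<Sum>i\<in>I. ennreal (diameter (U i) powr s))"
    by (rule sum.reindex_bij_betw[OF h])
  also have "\<dots> = ennreal (\<Sum>i\<in>I. diameter (U i) powr s)"
    by (simp add: sum_ennreal)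
  also have "\<dots> < ennreal \<epsilon>"
    using U(4) by (simp add: ennreal_less_iff sum_nonneg)
  finally have "(\<Sum>k. ennreal (diameter (W k) powr s)) < ennreal \<epsilon>" .
  moreover have "A \<subseteq> (\<Union>k. W k)"
  proof
    fix x assume "x \<in> A"
    then obtain i where "i \<in> I" "x \<in> U i" using U(2) by blast
    moreover obtain k where "k < card I" "h k = i"
      using bij_betw_imp_surj_on[OF h] \<open>i \<in> I\<close> by (metis atLeastLessThan_iff imageE)
    ultimately have "x \<in> W k" by (simp add: W_def)
    then show "x \<in> (\<Union>k. W k)" by blast
  qed
  moreover have "bounded (W k)" for k
    using U(3) bij_betwE[OF h] by (simp add: W_def)
  ultimately show "\<exists>U :: nat \<Rightarrow> 'a set. A \<subseteq> (\<Union>i. U i) \<and> (\<forall>i. bounded (U i)) \<and>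
        (\<Sum>i. ennreal (diameter (U i) powr s)) < ennreal \<epsilon>"
    by (intro exI[of _ W] conjI allI)
qed

lemma hausdorff_null_linear_image:
  fixes f :: "'a::euclidean_space \<Rightarrow> 'b::real_normed_vector"
  assumes "hausdorff_null s A" and "s > 0" and "linear f"
  shows "hausdorff_null s (f ` A)"
proof -
  obtain L where L: "L > 0" "\<And>x. norm (f x) \<le> L * norm x"
    using linear_bounded_pos[OF assms(3)] by blast
  show ?thesis
    using assms(1,2) L(1)
  proof (rule hausdorff_null_lipschitz_image)
    show "dist (f x) (f y) \<le> L * dist x y" for x y
      using L(2)[of "x - y"] by (simp add: dist_norm linear_diff[OF assms(3)])
  qed
qed

text \<open>A cover of a \<open>d\<close>-dimensional disc is thickened to boxes in the whole space, of volume
  \<open>(2 r)\<^sup>d\<close> for a member of diameter \<open>r\<close>, which together contain a box of fixed volume.\<close>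

lemma hausdorff_null_imp_dim_le:
  fixes V A :: "'a::euclidean_space set"
  assumes null: "hausdorff_null s A" and "subspace V" and "a \<in> V" and "\<rho> > 0"
    and sub: "V \<inter> cball a \<rho> \<subseteq> A" and "dim V > 0" and "s > 0"
  shows "real (dim V) \<le> s"
proof (rule ccontr)
  assume "\<not> real (dim V) \<le> s"
  then have s: "s \<le> real (dim V)" by simp
  define d where "d = dim V"
  have "d > 0" using \<open>dim V > 0\<close> by (simp add: d_def)
  have "d \<le> card (Basis :: 'a set)"
    unfolding d_def using dim_subset_UNIV[of V] by simp
  then obtain J :: "'a set" where J: "J \<subseteq> Basis" "card J = d"
    by (meson obtain_subset_with_card_n)
  have "finite J" using J(1) finite_Basis by (rule finite_subset)
  have "independent J"
    using independent_Basis J(1) by (rule independent_mono)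
  then have "dim (span J) = d"
    using J(2) by (simp add: dim_eq_card_independent)
  \<comment> \<open>The disc is parametrised isometrically by \<open>d\<close> of the coordinates,
    which frees the others for the thickening.\<close>
  obtain g where g: "linear g" "g \<in> span J \<rightarrow> V" "\<And>x. x \<in> span J \<Longrightarrow> norm (g x) = norm x"
  proof (rule isometry_subset_subspace)
    show "dim (span J) \<le> dim V" using \<open>dim (span J) = d\<close> by (simp add: d_def)
  qed (use \<open>subspace V\<close> in auto)
  define p where "p = (\<lambda>y::'a. \<Sum>b\<in>J. (y \<bullet> b) *\<^sub>R b)"
  have p_span: "p y \<in> span J" for y
    unfolding p_def by (intro span_sum span_scale span_base)
  have p_inner: "p y \<bullet> b = y \<bullet> b" if "b \<in> J" for y b
  proof -
    have "p y \<bullet> b = (\<Sum>c\<in>J. (y \<bullet> c) * (c \<bullet> b))"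
      by (simp add: p_def inner_sum_left)
    also have "\<dots> = (\<Sum>c\<in>J. if c = b then y \<bullet> c else 0)"
      using J(1) that by (intro sum.cong refl) (simp add: inner_Basis subset_eq)
    finally show ?thesis using that \<open>finite J\<close> by simp
  qed
  have p_diff: "p x - p y = p (x - y)" for x y
    by (simp add: p_def inner_diff_left scaleR_diff_left sum_subtractf)
  \<comment> \<open>\<open>h\<close> forgets the coordinates outside \<open>J\<close>, so the
    preimage of a set of diameter \<open>r\<close> has extent at most \<open>r\<close> in each
    direction of \<open>J\<close>.\<close>
  define h where "h = (\<lambda>y. a + g (p y))"
  have h_V: "h y \<in> V" for y
    unfolding h_def using g(2) p_span \<open>subspace V\<close> \<open>a \<in> V\<close> by (auto intro: subspace_add)
  have h_dist: "\<bar>(x - y) \<bullet> b\<bar> \<le> dist (h x) (h y)" if "b \<in> J" for x y b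
  proof -
    have "dist (h x) (h y) = norm (g (p x) - g (p y))"
      by (simp add: h_def dist_norm)
    also have "\<dots> = norm (p (x - y))"
      by (simp add: linear_diff[OF g(1), symmetric] p_diff g(3) p_span)
    finally show ?thesis
      using p_inner[OF that, of "x - y"] Basis_le_norm[of b "p (x - y)"] J(1) that by auto
  qed
  \<comment> \<open>The norm of \<open>p z\<close> is at most the sum of its \<open>d\<close>
    absolute coordinates, so this half-width keeps \<open>h z\<close> within \<open>\<rho>\<close>
    of \<open>a\<close>.\<close>
  define \<sigma> where "\<sigma> = \<rho> / d"
  have "\<sigma> > 0" using \<open>\<rho> > 0\<close> \<open>d > 0\<close> by (simp add: \<sigma>_def)
  \<comment> \<open>Length 1 in the directions outside \<open>J\<close> makes the full-dimensional
    volume equal to \<open>(2 * r) ^ d\<close>.\<close>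
  define box where "box = (\<lambda>(y::'a) r::real. cbox (\<Sum>b\<in>Basis. (if b \<in> J then y \<bullet> b - r else 0) *\<^sub>R b)
       (\<Sum>b\<in>Basis. (if b \<in> J then y \<bullet> b + r else 1) *\<^sub>R b))"
  have box_iff: "z \<in> box y r \<longleftrightarrow>
      (\<forall>b\<in>Basis. if b \<in> J then \<bar>(z - y) \<bullet> b\<bar> \<le> r else 0 \<le> z \<bullet> b \<and> z \<bullet> b \<le> 1)" for z y r
    unfolding box_def mem_box
    by (intro ball_cong refl) (auto simp: inner_diff_left)
  have box_measure: "emeasure lborel (box y r) = ennreal ((2 * r) ^ d)" if "r \<ge> 0" for y r
  proof -
    have "emeasure lborel (box y r) =
        ennreal (\<Prod>b\<in>Basis. (if b \<in> J then y \<bullet> b + r else 1) - (if b \<in> J then y \<bullet> b - r else 0))"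
      unfolding box_def using that by (subst emeasure_lborel_cbox) (auto simp: inner_diff_left)
    also have "(\<Prod>b\<in>Basis. (if b \<in> J then y \<bullet> b + r else 1) - (if b \<in> J then y \<bullet> b - r else 0))
        = (\<Prod>b\<in>Basis. if b \<in> J then 2 * r else 1)"
      by (intro prod.cong) auto
    also have "\<dots> = (2 * r) ^ d"
      using J by (simp add: prod.inter_restrict[symmetric] Int_absorb1)
    finally show ?thesis .
  qed
  \<comment> \<open>The bound 1 forces all diameters below 1, so that
    \<open>r ^ d \<le> r powr s\<close>; the bound \<open>\<sigma> ^ d / 2\<close> makes the final
    comparison of volumes contradictory.\<close>
  define \<epsilon> where "\<epsilon> = min 1 (\<sigma> ^ d / 2)"
  have "\<epsilon> > 0" using \<open>\<sigma> > 0\<close> by (simp add: \<epsilon>_def)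
  obtain U :: "nat \<Rightarrow> 'a set" where U: "A \<subseteq> (\<Union>i. U i)" "\<And>i. bounded (U i)"
      and small: "(\<Sum>i. ennreal (diameter (U i) powr s)) < ennreal \<epsilon>"
    using hausdorff_nullE[OF null \<open>\<epsilon> > 0\<close>] by metis
  define r where "r = (\<lambda>i. diameter (U i))"
  have r0: "r i \<ge> 0" for i unfolding r_def using U(2) by (rule diameter_ge_0)
  have r1: "r i ^ d \<le> r i powr s" for i
  proof (cases "r i = 0")
    case True
    then show ?thesis using \<open>d > 0\<close> by (simp add: zero_power)
  next
    case False
    then have "r i > 0" using r0[of i] by simp
    have "r i powr s < 1"
      using powr_diameter_less[OF small, of i] by (simp add: r_def \<epsilon>_def)
    have "r i ^ d = r i powr real d"
      using \<open>r i > 0\<close> by (simp add: powr_realpow)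
    also have "\<dots> \<le> r i powr s"
    proof (rule powr_mono')
      show "r i \<le> 1"
      proof (rule ccontr)
        assume "\<not> r i \<le> 1"
        then have "1 \<le> r i powr s" using \<open>s > 0\<close> by (intro ge_one_powr_ge_zero) auto
        with \<open>r i powr s < 1\<close> show False by simp
      qed
    qed (use s \<open>r i > 0\<close> in \<open>auto simp: d_def\<close>)
    finally show ?thesis .
  qed
  \<comment> \<open>A member missed by \<open>h\<close> gets an arbitrary centre; the covering
    argument visits only members that contain some \<open>h z\<close>.\<close>
  define y where "y = (\<lambda>i. SOME z. h z \<in> U i)"
  have cover: "box 0 \<sigma> \<subseteq> (\<Union>i. box (y i) (r i))"
  proof
    fix z assume z: "z \<in> box 0 \<sigma>"
    have "dist a (h z) = norm (p z)"
      by (simp add: h_def dist_norm g(3) p_span)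
    also have "\<dots> \<le> (\<Sum>b\<in>J. norm ((z \<bullet> b) *\<^sub>R b))"
      unfolding p_def by (rule norm_sum)
    also have "\<dots> \<le> (\<Sum>b\<in>J. \<sigma>)"
    proof (rule sum_mono)
      fix b assume "b \<in> J"
      then have "b \<in> Basis" using J(1) by blast
      with z \<open>b \<in> J\<close> have "\<bar>(z - 0) \<bullet> b\<bar> \<le> \<sigma>" unfolding box_iff by presburger
      with \<open>b \<in> Basis\<close> show "norm ((z \<bullet> b) *\<^sub>R b) \<le> \<sigma>" by simp
    qed
    also have "\<dots> = \<rho>" using J(2) \<open>d > 0\<close> by (simp add: \<sigma>_def)
    finally have "h z \<in> A" using sub h_V by auto
    then obtain i where i: "h z \<in> U i" using U(1) by blast
    then have yi: "h (y i) \<in> U i" unfolding y_def by (rule someI)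
    have "\<bar>(z - y i) \<bullet> b\<bar> \<le> r i" if "b \<in> J" for b
      using h_dist[OF that, of z "y i"] diameter_bounded_bound[OF U(2) i yi] by (simp add: r_def)
    then have "z \<in> box (y i) (r i)"
      using z unfolding box_iff by auto
    then show "z \<in> (\<Union>i. box (y i) (r i))" by blast
  qed
  have "ennreal ((2 * \<sigma>) ^ d) = emeasure lborel (box 0 \<sigma>)"
    using \<open>\<sigma> > 0\<close> by (simp add: box_measure)
  also have "\<dots> \<le> emeasure lborel (\<Union>i. box (y i) (r i))"
    using cover by (intro emeasure_mono) (auto simp: box_def)
  also have "\<dots> \<le> (\<Sum>i. emeasure lborel (box (y i) (r i)))"
    by (intro emeasure_subadditive_countably) (auto simp: box_def)
  also have "\<dots> = (\<Sum>i. ennreal (2 ^ d) * ennreal (r i ^ d))"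
    by (simp add: box_measure r0 power_mult_distrib ennreal_mult)
  also have "\<dots> \<le> (\<Sum>i. ennreal (2 ^ d) * ennreal (r i powr s))"
    by (intro suminf_le mult_left_mono ennreal_leI r1) auto
  also have "\<dots> = ennreal (2 ^ d) * (\<Sum>i. ennreal (r i powr s))"
    by (rule ennreal_suminf_cmult)
  also have "\<dots> \<le> ennreal (2 ^ d) * ennreal \<epsilon>"
    using small by (intro mult_left_mono) (auto simp: r_def)
  also have "\<dots> = ennreal (2 ^ d * \<epsilon>)"
    by (subst ennreal_mult) (use \<open>\<epsilon> > 0\<close> in auto)
  finally have "(2 * \<sigma>) ^ d \<le> 2 ^ d * \<epsilon>"
    using \<open>\<epsilon> > 0\<close> by (subst (asm) ennreal_le_iff) auto
  then have "\<sigma> ^ d \<le> \<sigma> ^ d / 2"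
    by (simp add: power_mult_distrib \<epsilon>_def)
  then show False using \<open>\<sigma> > 0\<close> by simp
qed

section \<open>Bounds on the Hausdorff dimension\<close>

lemma hausdorff_dim_le:
  assumes "s > 0" and "hausdorff_null s A"
  shows "hausdorff_dim A \<le> ereal s"
  unfolding hausdorff_dim_def using assms
  by (intro Inf_lower) (auto simp: hausdorff_measure_eq_0_iff)

lemma hausdorff_dim_nonneg: "0 \<le> hausdorff_dim A"
  unfolding hausdorff_dim_def by (rule Inf_greatest) auto

lemma hausdorff_dim_ge:
  fixes V A :: "'a::euclidean_space set"
  assumes "subspace V" and "a \<in> V" and "\<rho> > 0" and "V \<inter> cball a \<rho> \<subseteq> A" and "dim V > 0"
  shows "ereal (real (dim V)) \<le> hausdorff_dim A"
  unfolding hausdorff_dim_def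
proof (rule Inf_greatest)
  fix t assume "t \<in> {ereal s |s. 0 < s \<and> hausdorff_measure s A = 0}"
  then obtain s where s: "t = ereal s" "s > 0" "hausdorff_null s A"
    by (auto simp: hausdorff_measure_eq_0_iff)
  from hausdorff_null_imp_dim_le[OF s(3) assms s(2)] show "ereal (real (dim V)) \<le> t"
    by (simp add: s(1))
qed

section \<open>Zero sets of quadratic forms\<close>

lemma card_int_diameter_le:
  fixes T :: "int set" and w :: real
  assumes w: "\<And>j k. j \<in> T \<Longrightarrow> k \<in> T \<Longrightarrow> \<bar>real_of_int j - real_of_int k\<bar> \<le> w" and "w \<ge> 0"
  shows "finite T \<and> real (card T) \<le> w + 1"
proof (cases "T = {}")
  case True
  then show ?thesis using \<open>w \<ge> 0\<close> by simp
next
  case False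
  then obtain i where "i \<in> T" by blast
  \<comment> \<open>Finiteness comes first, because \<open>Min\<close> and \<open>Max\<close> are
    meaningful only for finite sets; the sharp count is read off from
    \<open>{Min T..Max T}\<close>.\<close>
  have "T \<subseteq> {i - \<lceil>w\<rceil>..i + \<lceil>w\<rceil>}"
  proof
    fix j assume "j \<in> T"
    then have "\<bar>real_of_int j - real_of_int i\<bar> \<le> w" using w \<open>i \<in> T\<close> by blast
    then show "j \<in> {i - \<lceil>w\<rceil>..i + \<lceil>w\<rceil>}"
      unfolding atLeastAtMost_iff by linarith
  qed
  then have fin: "finite T" by (rule finite_subset) simp
  have "T \<subseteq> {Min T..Max T}" using fin by auto
  then have "card T \<le> card {Min T..Max T}" by (intro card_mono) auto
  moreover have "Min T \<le> Max T" using fin False by simp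
  moreover have "\<bar>real_of_int (Max T) - real_of_int (Min T)\<bar> \<le> w"
    using w fin False by (meson Max_in Min_in)
  ultimately show ?thesis using fin by simp
qed

text \<open>The point is that the bound does not depend on \<open>\<beta>\<close> and \<open>\<gamma>\<close>.\<close>

lemma card_quadratic_small:
  fixes \<alpha> \<beta> \<gamma> \<eta> :: real
  assumes "\<alpha> \<noteq> 0" and "\<eta> \<ge> 0"
  defines "S \<equiv> {k::int. \<bar>\<alpha> * (of_int k)\<^sup>2 + \<beta> * of_int k + \<gamma>\<bar> \<le> \<eta>}"
  shows "finite S \<and> real (card S) \<le> 2 * (sqrt (2 * \<eta> / \<bar>\<alpha>\<bar>) + 1)"
proof -
  \<comment> \<open>Completing the square: the polynomial is
    \<open>\<alpha> * ((k - c)\<^sup>2 - D)\<close>.\<close>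
  define c where "c = - \<beta> / (2 * \<alpha>)"
  define D where "D = c\<^sup>2 - \<gamma> / \<alpha>"
  define w where "w = sqrt (2 * \<eta> / \<bar>\<alpha>\<bar>)"
  have "w \<ge> 0" using assms by (simp add: w_def)
  have square: "\<bar>(real_of_int k - c)\<^sup>2 - D\<bar> \<le> \<eta> / \<bar>\<alpha>\<bar>" if "k \<in> S" for k
  proof -
    have "\<alpha> * (of_int k)\<^sup>2 + \<beta> * of_int k + \<gamma> = \<alpha> * ((real_of_int k - c)\<^sup>2 - D)"
      using \<open>\<alpha> \<noteq> 0\<close> by (simp add: c_def D_def field_simps power2_eq_square)
    then have "\<bar>\<alpha>\<bar> * \<bar>(real_of_int k - c)\<^sup>2 - D\<bar> \<le> \<eta>"
      using that by (simp add: S_def abs_mult)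
    then show ?thesis using \<open>\<alpha> \<noteq> 0\<close> by (simp add: field_simps)
  qed
  \<comment> \<open>For nonnegative numbers the square of the difference is at most the difference
    of the squares in absolute value, and both squares are close to \<open>D\<close>.\<close>
  have diff: "\<bar>u - v\<bar> \<le> w"
    if "0 \<le> u" "0 \<le> v" "\<bar>u\<^sup>2 - D\<bar> \<le> \<eta> / \<bar>\<alpha>\<bar>" "\<bar>v\<^sup>2 - D\<bar> \<le> \<eta> / \<bar>\<alpha>\<bar>" for u v :: real
  proof -
    have "\<bar>u - v\<bar>\<^sup>2 = \<bar>u - v\<bar> * \<bar>u - v\<bar>" by (simp add: power2_eq_square)
    also have "\<dots> \<le> \<bar>u - v\<bar> * (u + v)" using that by (intro mult_left_mono) auto
    also have "\<dots> = \<bar>u\<^sup>2 - v\<^sup>2\<bar>"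
      using that by (simp add: square_diff_square_factored power2_eq_square abs_mult)
    also have "\<dots> \<le> 2 * \<eta> / \<bar>\<alpha>\<bar>"
    proof -
      have "2 * \<eta> / \<bar>\<alpha>\<bar> = \<eta> / \<bar>\<alpha>\<bar> + \<eta> / \<bar>\<alpha>\<bar>" by simp
      then show ?thesis using that(3,4) by linarith
    qed
    finally show ?thesis unfolding w_def by (rule real_le_rsqrt)
  qed
  \<comment> \<open>On either side of the vertex \<open>c\<close> the distances to \<open>c\<close>
    are nonnegative, as \<open>diff\<close> requires; the two sides account for the factor
    2.\<close>
  have right: "finite (S \<inter> {k. c \<le> k}) \<and> real (card (S \<inter> {k. c \<le> k})) \<le> w + 1"
  proof (rule card_int_diameter_le)
    fix j k assume "j \<in> S \<inter> {k. c \<le> k}" "k \<in> S \<inter> {k. c \<le> k}"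
    then show "\<bar>real_of_int j - real_of_int k\<bar> \<le> w"
      using diff[of "j - c" "k - c"] square by simp
  qed fact
  have left: "finite (S \<inter> {k. k < c}) \<and> real (card (S \<inter> {k. k < c})) \<le> w + 1"
  proof (rule card_int_diameter_le)
    fix j k assume "j \<in> S \<inter> {k. k < c}" "k \<in> S \<inter> {k. k < c}"
    then show "\<bar>real_of_int j - real_of_int k\<bar> \<le> w"
      using diff[of "c - j" "c - k"] square by (simp add: power2_commute)
  qed fact
  have S: "S = (S \<inter> {k. c \<le> k}) \<union> (S \<inter> {k. k < c})" by auto
  have "finite S" using left right by (subst S) simp
  have "card S \<le> card (S \<inter> {k. c \<le> k}) + card (S \<inter> {k. k < c})"
    by (subst S) (rule card_Un_le)
  then have "real (card S) \<le> real (card (S \<inter> {k. c \<le> k})) + real (card (S \<inter> {k. k < c}))"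
    by linarith
  also have "\<dots> \<le> 2 * (sqrt (2 * \<eta> / \<bar>\<alpha>\<bar>) + 1)"
    using left right by (simp add: w_def)
  finally show ?thesis using \<open>finite S\<close> by blast
qed

text \<open>With mesh \<open>1/m\<close>, a bounded piece is covered by balls of diameter
  \<open>O(1/m)\<close> around \<open>O(sqrt m)\<close> points on each of
  \<open>O(m ^ (d - 1))\<close> lines. The sum is \<open>O(m powr (d - 1/2 - s))\<close>, which
  tends to 0.\<close>

lemma hausdorff_null_quadric:
  fixes \<beta> :: "'a::euclidean_space \<Rightarrow> 'a \<Rightarrow> real" and V :: "'a set"
  assumes "bounded_bilinear \<beta>" and "subspace V" and "e \<in> V" and e: "\<beta> e e \<noteq> 0"
    and s: "real (dim V) - 1/2 < s"
  shows "hausdorff_null s {x \<in> V. \<beta> x x = 0}"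
proof -
  interpret \<beta>: bounded_bilinear \<beta> by fact
  have "e \<noteq> 0" using e by (auto simp: \<beta>.zero_left)
  then have "independent {e}" by simp
  \<comment> \<open>The basis contains \<open>e\<close> because the grid lines run in this
    direction, in which the form does not vanish.\<close>
  then obtain B where B: "{e} \<subseteq> B" "B \<subseteq> V" "independent B" "V \<subseteq> span B"
    using maximal_independent_subset_extend[of "{e}" V] \<open>e \<in> V\<close> by auto
  have "finite B" using B(3) by (rule independent_imp_finite)
  define d where "d = card B"
  have d: "d = dim V"
    unfolding d_def by (rule basis_card_eq_dim) (use B in auto)
  define R where "R = B - {e}"
  have BR: "B = insert e R" "e \<notin> R" "finite R"
    using B(1) \<open>finite B\<close> by (auto simp: R_def)
  have cardR: "card R = d - 1" and "d > 0"
    using BR by (simp_all add: d_def)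
  define \<Lambda> where "\<Lambda> = (\<Sum>b\<in>B. norm b)"
  have "\<Lambda> > 0"
    unfolding \<Lambda>_def BR using BR \<open>e \<noteq> 0\<close> by (simp add: sum_nonneg add_pos_nonneg)
  obtain M where "M > 0" and M: "\<And>x y. norm (\<beta> x y) \<le> norm x * norm y * M"
    using \<beta>.pos_bounded by blast
  define comb where "comb = (\<lambda>c. \<Sum>b\<in>B. c b *\<^sub>R b)"
  have comb_norm: "norm (comb c) \<le> r * \<Lambda>" if "\<And>b. b \<in> B \<Longrightarrow> \<bar>c b\<bar> \<le> r" for c r
  proof -
    have "norm (comb c) \<le> (\<Sum>b\<in>B. norm (c b *\<^sub>R b))"
      unfolding comb_def by (rule norm_sum)
    also have "\<dots> \<le> (\<Sum>b\<in>B. r * norm b)"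
      using that by (intro sum_mono) (simp add: mult_right_mono)
    finally show ?thesis by (simp add: \<Lambda>_def sum_distrib_left)
  qed
  define Z where "Z = (\<lambda>K::nat. {comb c |c. (\<forall>b\<in>B. \<bar>c b\<bar> \<le> real K) \<and> \<beta> (comb c) (comb c) = 0})"
  have null: "hausdorff_null s (Z K)" for K
  proof (rule hausdorff_nullI_finite_cover)
    fix \<epsilon> :: real assume "\<epsilon> > 0"
    \<comment> \<open>Passing from a zero of the form to a grid point at distance at most
      \<open>\<Lambda> / m\<close>, both of norm at most \<open>K * \<Lambda>\<close>, changes the
      value by at most \<open>L / m\<close>.\<close>
    define L where "L = 2 * M * K * \<Lambda> * \<Lambda>"
    have "L \<ge> 0" using \<open>M > 0\<close> \<open>\<Lambda> > 0\<close> by (simp add: L_def)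
    define \<kappa> where "\<kappa> = 2 * (sqrt (2 * L / \<bar>\<beta> e e\<bar>) + 1)"
    have "\<kappa> \<ge> 0" using \<open>L \<ge> 0\<close> by (simp add: \<kappa>_def)
    define const where "const = (2 * real K + 1) ^ (d - 1) * \<kappa> * (2 * \<Lambda>) powr s"
    have "((\<lambda>m. const * real m powr (real d - 1/2 - s)) \<longlongrightarrow> const * 0) sequentially"
      using s d by (intro tendsto_mult tendsto_const tendsto_neg_powr filterlim_real_sequentially) auto
    then have "\<forall>\<^sub>F m in sequentially. const * real m powr (real d - 1/2 - s) < \<epsilon>"
      using \<open>\<epsilon> > 0\<close> by (intro order_tendstoD) auto
    then have "\<forall>\<^sub>F m in sequentially. const * real m powr (real d - 1/2 - s) < \<epsilon> \<and> 1 \<le> m"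
      using eventually_ge_at_top by (rule eventually_conj)
    then obtain m :: nat where m: "const * real m powr (real d - 1/2 - s) < \<epsilon>" "1 \<le> m"
      using eventually_happens'[OF sequentially_bot] by blast
    define pt where "pt = (\<lambda>k (j::int). (\<Sum>b\<in>R. (real_of_int (k b) / m) *\<^sub>R b) + (j / m) *\<^sub>R e)"
    define N where "N = int (K * m)"
    define fib where "fib = (\<lambda>k. {j. \<bar>\<beta> (pt k j) (pt k j)\<bar> \<le> L / m})"
    have fib: "finite (fib k) \<and> real (card (fib k)) \<le> \<kappa> * sqrt m" for k
    proof -
      define y where "y = (\<Sum>b\<in>R. (real_of_int (k b) / m) *\<^sub>R b)"
      \<comment> \<open>Along a grid line the form is quadratic in \<open>j\<close>. The index
        \<open>k\<close> of the line enters only through the two lower coefficients, on which the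
        count does not depend.\<close>
      have pt: "\<beta> (pt k j) (pt k j) =
          (\<beta> e e / m\<^sup>2) * (of_int j)\<^sup>2 + ((\<beta> y e + \<beta> e y) / m) * of_int j + \<beta> y y" for j
        unfolding pt_def y_def[symmetric]
        by (simp add: \<beta>.add_left \<beta>.add_right \<beta>.scaleR_left \<beta>.scaleR_right
            power2_eq_square algebra_simps add_divide_distrib)
      have "finite (fib k) \<and> real (card (fib k)) \<le> 2 * (sqrt (2 * (L / m) / \<bar>\<beta> e e / m\<^sup>2\<bar>) + 1)"
        unfolding fib_def pt using e m(2) \<open>L \<ge> 0\<close> by (intro card_quadratic_small) auto
      then have "finite (fib k)" "real (card (fib k)) \<le> 2 * (sqrt (2 * (L / m) / \<bar>\<beta> e e / m\<^sup>2\<bar>) + 1)"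
        by (rule conjunct1, rule conjunct2)
      moreover have "2 * (L / m) / \<bar>\<beta> e e / m\<^sup>2\<bar> = (2 * L / \<bar>\<beta> e e\<bar>) * m"
        using m(2) by (simp add: abs_divide power2_eq_square)
      \<comment> \<open>The summand 1 is absorbed by \<open>1 \<le> sqrt m\<close>.\<close>
      moreover have "2 * (sqrt ((2 * L / \<bar>\<beta> e e\<bar>) * m) + 1) \<le> \<kappa> * sqrt m"
        using m(2) unfolding \<kappa>_def real_sqrt_mult by (simp add: algebra_simps)
      ultimately show ?thesis by simp
    qed
    \<comment> \<open>Only the coordinates in \<open>R\<close> are confined to a box;
      \<open>j\<close> runs through the whole fibre, which is finite.\<close>
    define I where "I = Sigma (PiE R (\<lambda>_. {-N..N})) fib"
    define U where "U = (\<lambda>(k, j). cball (pt k j) (\<Lambda> / m))"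
    have finP: "finite (PiE R (\<lambda>_. {-N..N}))"
      using BR(3) by (intro finite_PiE) auto
    have "finite I"
      unfolding I_def using finP fib by (intro finite_SigmaI) auto
    moreover have "Z K \<subseteq> (\<Union>i\<in>I. U i)"
    proof
      fix x assume "x \<in> Z K"
      then obtain c where c: "x = comb c" "\<And>b. b \<in> B \<Longrightarrow> \<bar>c b\<bar> \<le> real K" "\<beta> x x = 0"
        by (auto simp: Z_def)
      \<comment> \<open>Rounding down moves each coordinate by at most \<open>1 / m\<close> and
        stays in \<open>{-N..N}\<close>, as \<open>N\<close> is an integer.\<close>
      define f where "f = (\<lambda>b. \<lfloor>c b * m\<rfloor>)"
      define k where "k = restrict f R"
      have f_bound: "f b \<in> {-N..N}" if "b \<in> B" for b
      proof -
        have "\<bar>c b * m\<bar> \<le> K * m"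
          using c(2)[OF that] by (simp add: abs_mult mult_right_mono)
        then have "- real_of_int N \<le> c b * m" "c b * m \<le> real_of_int N"
          by (simp_all add: N_def abs_le_iff)
        then show ?thesis unfolding f_def atLeastAtMost_iff by linarith
      qed
      then have "k \<in> PiE R (\<lambda>_. {-N..N})"
        unfolding k_def using BR(1) by auto
      define g where "g = pt k (f e)"
      have g: "g = comb (\<lambda>b. f b / m)"
        unfolding g_def pt_def comb_def k_def BR(1) using BR(2,3) by simp
      have "norm (x - g) = norm (comb (\<lambda>b. c b - f b / m))"
        unfolding g c(1) comb_def by (simp add: sum_subtractf scaleR_diff_left)
      also have "\<dots> \<le> (1 / m) * \<Lambda>"
      proof (rule comb_norm)
        fix b
        have "\<bar>c b * m - f b\<bar> \<le> 1" unfolding f_def by linarith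
        moreover have "c b - f b / m = (c b * m - f b) / m"
          using m(2) by (simp add: field_simps)
        ultimately show "\<bar>c b - f b / m\<bar> \<le> 1 / m"
          using m(2) by (simp add: abs_divide divide_right_mono)
      qed
      finally have xg: "norm (x - g) \<le> \<Lambda> / m" by simp
      have nx: "norm x \<le> K * \<Lambda>"
        unfolding c(1) by (rule comb_norm) (rule c(2))
      have ng: "norm g \<le> K * \<Lambda>"
        unfolding g
      proof (rule comb_norm)
        fix b assume "b \<in> B"
        then have "- real_of_int N \<le> f b" "f b \<le> real_of_int N"
          using f_bound[of b] by (simp_all only: atLeastAtMost_iff of_int_le_iff of_int_minus[symmetric])
        then show "\<bar>f b / m\<bar> \<le> K"
          using m(2) by (simp add: N_def abs_divide field_simps abs_le_iff)
      qed
      \<comment> \<open>Since \<open>\<beta> x x = 0\<close>, the value at \<open>g\<close> is a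
        difference that is linear in \<open>g - x\<close>, up to bounded factors.\<close>
      have "\<beta> g g = \<beta> (g - x) g + \<beta> x (g - x)"
        using c(3) by (simp add: \<beta>.diff_left \<beta>.diff_right)
      also have "\<bar>\<dots>\<bar> \<le> norm (g - x) * norm g * M + norm x * norm (g - x) * M"
        using M[of "g - x" g] M[of x "g - x"] by simp
      also have "\<dots> = norm (x - g) * (norm g + norm x) * M"
        by (simp add: norm_minus_commute algebra_simps)
      also have "\<dots> \<le> (\<Lambda> / m) * (K * \<Lambda> + K * \<Lambda>) * M"
        using xg nx ng \<open>M > 0\<close> \<open>\<Lambda> > 0\<close> by (intro mult_right_mono mult_mono add_mono) auto
      also have "\<dots> = L / m" by (simp add: L_def)
      finally have "f e \<in> fib k" by (simp add: fib_def g_def)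
      with \<open>k \<in> PiE R (\<lambda>_. {-N..N})\<close> have "(k, f e) \<in> I" by (simp add: I_def)
      moreover have "x \<in> U (k, f e)"
        using xg by (simp add: U_def g_def dist_norm norm_minus_commute)
      ultimately show "x \<in> (\<Union>i\<in>I. U i)" by blast
    qed
    moreover have "\<forall>i\<in>I. bounded (U i)"
      by (auto simp: U_def)
    moreover have "(\<Sum>i\<in>I. diameter (U i) powr s) < \<epsilon>"
    proof -
      have "real (card I) = (\<Sum>k\<in>PiE R (\<lambda>_. {-N..N}). real (card (fib k)))"
        unfolding I_def using finP fib by (subst card_SigmaI) auto
      also have "\<dots> \<le> (\<Sum>k\<in>PiE R (\<lambda>_. {-N..N}). \<kappa> * sqrt m)"
        using fib by (intro sum_mono) auto
      also have "\<dots> = (2 * real K * m + 1) ^ (d - 1) * (\<kappa> * sqrt m)"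
        using BR(3) by (simp add: card_PiE cardR N_def nat_add_distrib nat_mult_distrib ac_simps)
      also have "\<dots> \<le> ((2 * real K + 1) * m) ^ (d - 1) * (\<kappa> * sqrt m)"
        using m(2) \<open>\<kappa> \<ge> 0\<close> by (intro mult_right_mono power_mono) (auto simp: algebra_simps)
      finally have cardI: "real (card I) \<le> ((2 * real K + 1) * m) ^ (d - 1) * (\<kappa> * sqrt m)" .
      have "diameter (U i) = 2 * \<Lambda> / m" for i
        using \<open>\<Lambda> > 0\<close> m(2) by (simp add: U_def divide_less_0_iff split: prod.split)
      then have "(\<Sum>i\<in>I. diameter (U i) powr s) = card I * (2 * \<Lambda> / m) powr s"
        by simp
      also have "\<dots> \<le> ((2 * real K + 1) * m) ^ (d - 1) * (\<kappa> * sqrt m) * (2 * \<Lambda> / m) powr s"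
        using cardI by (rule mult_right_mono) simp
      also have "\<dots> = const * real m powr (real d - 1/2 - s)"
      proof -
        have "real m ^ (d - 1) = real m powr (real d - 1)"
          using m(2) \<open>d > 0\<close> by (simp add: powr_realpow[symmetric] of_nat_diff)
        moreover have "sqrt (real m) = real m powr (1/2)"
          using m(2) by (simp add: powr_half_sqrt)
        moreover have "(2 * \<Lambda> / m) powr s = (2 * \<Lambda>) powr s * real m powr (- s)"
          using \<open>\<Lambda> > 0\<close> by (simp add: powr_divide powr_minus_divide)
        moreover have "real m powr (real d - 1/2 - s) =
            real m powr (real d - 1) * real m powr (1/2) * real m powr (- s)"
          unfolding powr_add[symmetric] by (rule arg_cong[where f = "\<lambda>t. real m powr t"]) simp
        ultimately show ?thesis by (simp add: const_def power_mult_distrib)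
      qed
      finally show ?thesis using m(1) by linarith
    qed
    ultimately show "\<exists>(I :: (('a \<Rightarrow> int) \<times> int) set) U. finite I \<and> Z K \<subseteq> (\<Union>i\<in>I. U i) \<and>
      (\<forall>i\<in>I. bounded (U i)) \<and> (\<Sum>i\<in>I. diameter (U i) powr s) < \<epsilon>"
      by (intro exI[of _ I] exI[of _ U] conjI)
  qed
  have "{x \<in> V. \<beta> x x = 0} \<subseteq> (\<Union>K. Z K)"
  proof
    fix x assume x: "x \<in> {x \<in> V. \<beta> x x = 0}"
    then have "x \<in> span B" using B(4) by blast
    then obtain c where c: "x = comb c"
      unfolding span_finite[OF \<open>finite B\<close>] comb_def by blast
    obtain K :: nat where K: "(\<Sum>b\<in>B. \<bar>c b\<bar>) \<le> K" using real_arch_simple by blast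
    have "\<bar>c b\<bar> \<le> K" if "b \<in> B" for b
      using member_le_sum[OF that, of "\<lambda>b. \<bar>c b\<bar>"] \<open>finite B\<close> K by simp
    with x c have "x \<in> Z K" by (auto simp: Z_def)
    then show "x \<in> (\<Union>K. Z K)" by blast
  qed
  with hausdorff_null_UN_nat[OF null] show ?thesis by (rule hausdorff_null_subset)
qed

section \<open>Invariant lattices\<close>

text \<open>The orbit of any point serves as \<open>S\<close>. If it were everything,
  \<open>\<tau>\<close> would be the cycle that runs through it.\<close>

lemma not_full_cycle_invariant_set:
  fixes \<tau> :: "'n::finite \<Rightarrow> 'n"
  assumes "\<tau> permutes UNIV" and "\<not> full_cycle \<tau>"
  obtains S where "S \<noteq> {}" "S \<noteq> UNIV" "\<And>i. \<tau> i \<in> S \<longleftrightarrow> i \<in> S"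
proof -
  have perm: "permutation \<tau>"
    using assms(1) finite by (auto simp: permutation_permutes)
  fix a :: 'n
  define cs where "cs = support \<tau> a"
  have cs: "set cs = range (\<lambda>k. (\<tau> ^^ k) a)"
    unfolding cs_def by (rule support_set[OF perm])
  have "distinct cs"
    unfolding cs_def by (rule cycle_of_permutation[OF perm])
  show thesis
  proof (rule that)
    show "set cs \<noteq> {}" unfolding cs by simp
    show "set cs \<noteq> UNIV"
    proof
      assume UNIV: "set cs = UNIV"
      have "length cs = CARD('n)"
        using distinct_card[OF \<open>distinct cs\<close>] UNIV by simp
      moreover have "\<tau> = cycle_of_list cs"
      proof
        fix b
        show "\<tau> b = cycle_of_list cs b"
          using cycle_restrict[OF perm, of b a] UNIV unfolding cs_def by simp
      qed
      ultimately show False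
        using assms(2) \<open>distinct cs\<close> unfolding full_cycle_def by blast
    qed
    have fwd: "\<tau> i \<in> set cs" if i: "i \<in> set cs" for i
    proof -
      obtain k where "i = (\<tau> ^^ k) a" using i unfolding cs by (rule rangeE)
      then have "\<tau> i = (\<tau> ^^ Suc k) a" by simp
      then show ?thesis unfolding cs by (rule range_eqI)
    qed
    have "inj \<tau>" using assms(1) by (rule permutes_inj)
    \<comment> \<open>An injective self-map of a finite set is onto, which yields the converse of
      \<open>fwd\<close>.\<close>
    have "\<tau> ` set cs = set cs"
      using fwd inj_on_subset[OF \<open>inj \<tau>\<close>] by (intro endo_inj_surj) auto
    then show "\<tau> i \<in> set cs \<longleftrightarrow> i \<in> set cs" for i
      using inj_image_mem_iff[OF \<open>inj \<tau>\<close>, of i "set cs"] by simp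
  qed
qed

section \<open>Permutation matrices and their commutant\<close>

definition perm_mat :: "('n::finite \<Rightarrow> 'n) \<Rightarrow> real ^ 'n ^ 'n" where
  "perm_mat \<tau> = (\<chi> i j. if j = \<tau> i then 1 else 0)"

lemma perm_mat_mult_vec: "perm_mat \<tau> *v x = perm_act \<tau> x"
  by (simp add: perm_mat_def perm_act_def matrix_vector_mult_def vec_eq_iff if_distrib[of "\<lambda>c. c * _"]
      cong: if_cong)

definition commutant :: "real ^ 'n ^ 'n \<Rightarrow> (real ^ 'n ^ 'n::finite) set" where
  "commutant P = {C. P ** C = C ** P}"

lemma linear_matrix_mult_left: "linear (\<lambda>X. A ** X :: real ^ 'n ^ 'm)" for A :: "real ^ 'k ^ 'm"
  by (intro linearI)
    (simp_all add: matrix_matrix_mult_def vec_eq_iff sum.distrib sum_distrib_left algebra_simps)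

lemma linear_matrix_mult_right: "linear (\<lambda>X. X ** A :: real ^ 'n ^ 'm)" for A :: "real ^ 'n ^ 'k"
  by (intro linearI)
    (simp_all add: matrix_matrix_mult_def vec_eq_iff sum.distrib sum_distrib_left algebra_simps)

lemma subspace_commutant: "subspace (commutant P)"
proof -
  have "linear (\<lambda>C. P ** C - C ** P)"
    by (intro linear_compose_sub linear_matrix_mult_left linear_matrix_mult_right)
  from linear_subspace_kernel[OF this] show ?thesis
    by (simp add: commutant_def)
qed

lemma matrix_inv_inverse:
  assumes "invertible A"
  shows "A ** matrix_inv A = mat 1" "matrix_inv A ** A = mat 1"
  using someI_ex[OF assms[unfolded invertible_def]] unfolding matrix_inv_def by blast+

lemma finite_vec_components:
  assumes "finite S"
  shows "finite {z :: 'a ^ 'n::finite. \<forall>i. z $ i \<in> S}"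
proof (rule finite_subset)
  show "{z :: 'a ^ 'n. \<forall>i. z $ i \<in> S} \<subseteq> vec_lambda ` PiE UNIV (\<lambda>_. S)"
  proof
    fix z :: "'a ^ 'n" assume "z \<in> {z. \<forall>i. z $ i \<in> S}"
    then show "z \<in> vec_lambda ` PiE UNIV (\<lambda>_. S)"
      by (intro image_eqI[where x = "vec_nth z"]) auto
  qed
  show "finite (vec_lambda ` PiE (UNIV :: 'n set) (\<lambda>_. S))"
    using assms by (intro finite_imageI finite_PiE) auto
qed

section \<open>Basis matrices of invariant lattices\<close>

lemma lattice_of_basis_eq_image: "lattice_of_basis B = (*v) B ` {z. \<forall>i. z $ i \<in> \<int>}"
  unfolding lattice_of_basis_def by blast

text \<open>The action passes through \<open>C\<close> to the integral vectors, which it permutes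
  among themselves.\<close>

lemma invariant_if_commutant:
  fixes \<tau> :: "'n::finite \<Rightarrow> 'n"
  assumes "\<tau> permutes UNIV" and "C \<in> commutant (perm_mat \<tau>)"
  shows "perm_act \<tau> ` lattice_of_basis C = lattice_of_basis C"
proof -
  let ?Z = "{z :: real ^ 'n. \<forall>i. z $ i \<in> \<int>}"
  have "perm_act \<tau> (C *v z) = C *v perm_act \<tau> z" for z
    using assms(2) by (simp add: commutant_def perm_mat_mult_vec[symmetric] matrix_vector_mul_assoc)
  then have "perm_act \<tau> ` lattice_of_basis C = (*v) C ` perm_act \<tau> ` ?Z"
    unfolding lattice_of_basis_eq_image by (simp add: image_image)
  also have "perm_act \<tau> ` ?Z = ?Z"
  proof (intro set_eqI iffI)
    fix z assume "z \<in> ?Z"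
    moreover have "perm_act \<tau> (\<chi> i. z $ inv \<tau> i) = z"
      using permutes_inverses(2)[OF assms(1)] by (simp add: perm_act_def vec_eq_iff)
    ultimately show "z \<in> perm_act \<tau> ` ?Z"
      by (intro image_eqI[where x = "\<chi> i. z $ inv \<tau> i"]) auto
  qed (auto simp: perm_act_def)
  finally show ?thesis by (simp add: lattice_of_basis_eq_image)
qed

text \<open>The action sends each column of \<open>B\<close> to a lattice vector, whose integral
  coordinates form a column of \<open>M\<close>. This sorts the basis matrices into countably many
  families.\<close>

lemma invariant_imp_integral_conjugate:
  fixes \<tau> :: "'n::finite \<Rightarrow> 'n"
  assumes "perm_act \<tau> ` lattice_of_basis B = lattice_of_basis B"
  obtains M where "\<And>i j. M $ i $ j \<in> \<int>" "perm_mat \<tau> ** B = B ** M"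
proof -
  have "\<forall>j. \<exists>z. (\<forall>i. z $ i \<in> \<int>) \<and> perm_act \<tau> (B *v axis j 1) = B *v z"
  proof
    fix j
    have "B *v axis j 1 \<in> lattice_of_basis B"
      unfolding lattice_of_basis_eq_image by (intro imageI) (auto simp: axis_def)
    then have "perm_act \<tau> (B *v axis j 1) \<in> lattice_of_basis B"
      using assms by blast
    then show "\<exists>z. (\<forall>i. z $ i \<in> \<int>) \<and> perm_act \<tau> (B *v axis j 1) = B *v z"
      unfolding lattice_of_basis_def by blast
  qed
  from choice[OF this] obtain f where
    "\<forall>j. (\<forall>i. f j $ i \<in> \<int>) \<and> perm_act \<tau> (B *v axis j 1) = B *v f j" ..
  then have f: "\<And>i j. f j $ i \<in> \<int>" "\<And>j. perm_act \<tau> (B *v axis j 1) = B *v f j"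
    by auto
  define M where "M = (\<chi> i j. f j $ i)"
  have M: "M *v axis j 1 = f j" for j
    by (simp add: M_def matrix_vector_mult_basis column_def)
  have "(perm_mat \<tau> ** B) *v axis j 1 = (B ** M) *v axis j 1" for j
    by (simp add: matrix_vector_mul_assoc[symmetric] perm_mat_mult_vec f(2) M)
  then have "perm_mat \<tau> ** B = B ** M"
    by (simp add: matrix_vector_mult_basis column_def vec_eq_iff)
  then show thesis using f(1) by (intro that[of M]) (auto simp: M_def)
qed

text \<open>From \<open>M ** matrix_inv B' = matrix_inv B' ** P\<close> it follows that
  \<open>P\<close> passes through the quotient \<open>B ** matrix_inv B'\<close>. One invertible
  solution thus yields all others by left multiplication with the commutant.\<close>

lemma commutant_conjugate:
  assumes "P ** B = B ** M" "P ** B' = B' ** M" and "invertible B'"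
  shows "B ** matrix_inv B' \<in> commutant P" and "(B ** matrix_inv B') ** B' = B"
proof -
  note inv = matrix_inv_inverse[OF assms(3)]
  show eq: "(B ** matrix_inv B') ** B' = B"
    by (simp add: matrix_mul_assoc[symmetric] inv)
  have "matrix_inv B' ** (P ** B') = matrix_inv B' ** B' ** M"
    by (simp only: assms(2) matrix_mul_assoc)
  then have "M = matrix_inv B' ** P ** B'"
    by (simp add: inv matrix_mul_assoc)
  then have "P ** (B ** matrix_inv B') = B ** (matrix_inv B' ** P ** B') ** matrix_inv B'"
    by (simp add: matrix_mul_assoc assms(1))
  also have "\<dots> = B ** matrix_inv B' ** P"
    by (simp add: matrix_mul_assoc[symmetric] inv)
  finally show "B ** matrix_inv B' \<in> commutant P"
    by (simp add: commutant_def)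
qed

section \<open>Successive minima and minimal vectors\<close>

lemma finite_lattice_cball:
  fixes B :: "real ^ 'n ^ 'n::finite"
  assumes "invertible B"
  shows "finite (lattice_of_basis B \<inter> cball 0 r)"
proof -
  obtain K where K: "\<And>x. norm (matrix_inv B *v x) \<le> norm x * K" "K > 0"
    using bounded_linear.pos_bounded[OF matrix_vector_mul_bounded_linear, of "matrix_inv B"] by blast
  \<comment> \<open>The inverse matrix bounds the coordinates of every lattice vector of norm at
    most \<open>r\<close>.\<close>
  define T where "T = {z :: real ^ 'n. \<forall>i. z $ i \<in> {k \<in> \<int>. \<bar>k\<bar> \<le> r * K}}"
  have "finite T"
    unfolding T_def by (intro finite_vec_components finite_abs_int_segment)
  moreover have "lattice_of_basis B \<inter> cball 0 r \<subseteq> (*v) B ` T"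
  proof
    fix x assume x: "x \<in> lattice_of_basis B \<inter> cball 0 r"
    then obtain z where z: "x = B *v z" "\<forall>i. z $ i \<in> \<int>"
      by (auto simp: lattice_of_basis_def)
    have "z = matrix_inv B *v x"
      using matrix_inv_inverse(2)[OF assms] by (simp add: z(1) matrix_vector_mul_assoc)
    have "norm z \<le> r * K"
    proof -
      have "norm z \<le> norm x * K" using K(1)[of x] \<open>z = matrix_inv B *v x\<close> by simp
      also have "\<dots> \<le> r * K" using x K(2) by (intro mult_right_mono) auto
      finally show ?thesis .
    qed
    then have "\<bar>z $ i\<bar> \<le> r * K" for i
      using component_le_norm_cart[of z i] by linarith
    then have "z \<in> T" using z(2) by (simp add: T_def)
    then show "x \<in> (*v) B ` T" using z(1) by blast
  qed
  ultimately show ?thesis by (rule finite_subset[OF _ finite_imageI, rotated])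
qed

text \<open>\<open>LEAST\<close> on the reals has its expected properties only if the minimum is
  attained. It is, because the admissible radii can be reduced to the finitely many norms of lattice
  vectors in a ball.\<close>

lemma successive_minimum_props:
  fixes B :: "real ^ 'n ^ 'n::finite"
  assumes "invertible B" and "i \<in> {1..CARD('n)}"
  defines "\<Lambda> \<equiv> lattice_of_basis B"
  shows "0 < successive_minimum \<Lambda> i" and "i \<le> dim (\<Lambda> \<inter> cball 0 (successive_minimum \<Lambda> i))"
    and "\<And>r. 0 < r \<Longrightarrow> i \<le> dim (\<Lambda> \<inter> cball 0 r) \<Longrightarrow> successive_minimum \<Lambda> i \<le> r"
proof -
  define P where "P = (\<lambda>r. 0 < r \<and> i \<le> dim (\<Lambda> \<inter> cball 0 r))"
  define F where "F = (\<lambda>r. norm ` (\<Lambda> \<inter> cball 0 r))"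
  have fin: "finite (F r)" for r
    unfolding F_def \<Lambda>_def using finite_lattice_cball[OF assms(1)] by blast
  have shrink: "\<exists>r'\<in>F r. r' \<le> r \<and> P r'" if "P r" for r
  proof -
    have "\<not> \<Lambda> \<inter> cball 0 r \<subseteq> {0}"
    proof
      assume "\<Lambda> \<inter> cball 0 r \<subseteq> {0}"
      then have "dim (\<Lambda> \<inter> cball 0 r) \<le> dim {0 :: real ^ 'n}" by (rule dim_subset)
      moreover have "dim {0 :: real ^ 'n} = 0" by simp
      ultimately show False
        using that assms(2) unfolding P_def atLeastAtMost_iff by linarith
    qed
    then obtain x where x: "x \<in> \<Lambda> \<inter> cball 0 r" "x \<noteq> 0" by blast
    \<comment> \<open>Shrinking to the largest norm that occurs leaves the lattice points in the
      ball unchanged.\<close>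
    define r' where "r' = Max (F r)"
    have "norm x \<in> F r" using x by (auto simp: F_def)
    then have "norm x \<le> r'" "r' \<in> F r"
      unfolding r'_def using fin by (auto intro: Max_in)
    have "r' \<le> r" using \<open>r' \<in> F r\<close> by (auto simp: F_def)
    have "\<Lambda> \<inter> cball 0 r' = \<Lambda> \<inter> cball 0 r"
    proof
      show "\<Lambda> \<inter> cball 0 r' \<subseteq> \<Lambda> \<inter> cball 0 r" using \<open>r' \<le> r\<close> by auto
      show "\<Lambda> \<inter> cball 0 r \<subseteq> \<Lambda> \<inter> cball 0 r'"
        using fin[of r] by (auto simp: r'_def F_def intro!: Max_ge)
    qed
    moreover have "r' > 0" using less_le_trans[OF _ \<open>norm x \<le> r'\<close>, of 0] x(2) by simp
    ultimately have "P r'" using that by (simp add: P_def)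
    with \<open>r' \<in> F r\<close> \<open>r' \<le> r\<close> show ?thesis by blast
  qed
  have "\<exists>r. P r"
  proof -
    \<comment> \<open>This ball contains all columns of \<open>B\<close>, which span; the summand 1
      makes positivity immediate.\<close>
    define r where "r = 1 + (\<Sum>j\<in>UNIV. norm (B *v axis j 1))"
    have "r > 0" unfolding r_def by (intro add_pos_nonneg sum_nonneg) auto
    have col: "column j B \<in> \<Lambda> \<inter> cball 0 r" for j
    proof -
      have "norm (B *v axis j 1) \<le> (\<Sum>j\<in>UNIV. norm (B *v axis j 1))"
        by (rule member_le_sum) auto
      moreover have "B *v axis j 1 \<in> \<Lambda>"
        unfolding \<Lambda>_def lattice_of_basis_eq_image by (intro imageI) (auto simp: axis_def)
      ultimately show ?thesis by (simp add: r_def matrix_vector_mult_basis)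
    qed
    have "CARD('n) = rank B"
      using assms(1) unfolding invertible_right_inverse matrix_right_invertible_surjective
        full_rank_surjective[symmetric] by simp
    also have "\<dots> = dim (columns B)" by (simp add: column_rank_def)
    also have "\<dots> \<le> dim (\<Lambda> \<inter> cball 0 r)"
      using col by (intro dim_subset) (auto simp: columns_def)
    finally have "P r" using \<open>r > 0\<close> assms(2) by (simp add: P_def)
    then show ?thesis by blast
  qed
  then obtain R where "P R" by blast
  define G where "G = {r \<in> F R. P r}"
  have "finite G" "G \<noteq> {}"
    using fin shrink[OF \<open>P R\<close>] by (auto simp: G_def)
  define m where "m = Min G"
  have "m \<in> G" unfolding m_def using \<open>finite G\<close> \<open>G \<noteq> {}\<close> by (rule Min_in)
  have least: "m \<le> r" if Pr: "P r" for r
  proof (cases "r \<le> R")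
    case True
    obtain r' where "r' \<in> F r" "r' \<le> r" "P r'" using shrink[OF Pr] by blast
    moreover have "F r \<subseteq> F R" using True by (auto simp: F_def)
    ultimately have "r' \<in> G" by (auto simp: G_def)
    then have "m \<le> r'" unfolding m_def using \<open>finite G\<close> by simp
    with \<open>r' \<le> r\<close> show ?thesis by simp
  next
    case False
    have "m \<le> R" using \<open>m \<in> G\<close> by (auto simp: G_def F_def)
    with False show ?thesis by simp
  qed
  have "successive_minimum \<Lambda> i = m"
    unfolding successive_minimum_def P_def[symmetric]
    using \<open>m \<in> G\<close> least by (intro Least_equality) (auto simp: G_def)
  then show "0 < successive_minimum \<Lambda> i" "i \<le> dim (\<Lambda> \<inter> cball 0 (successive_minimum \<Lambda> i))"
    "\<And>r. 0 < r \<Longrightarrow> i \<le> dim (\<Lambda> \<inter> cball 0 r) \<Longrightarrow> successive_minimum \<Lambda> i \<le> r"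
    using \<open>m \<in> G\<close> least by (auto simp: G_def P_def)
qed

text \<open>No nonzero lattice vector is shorter than the first minimum. If the last minimum is the
  same number, the spanning vectors in that ball lie on its boundary, apart from 0.\<close>

lemma well_rounded_imp_spanning_sphere:
  fixes B :: "real ^ 'n ^ 'n::finite"
  assumes "invertible B" and "well_rounded (lattice_of_basis B)"
  obtains \<mu> where "span (lattice_of_basis B \<inter> sphere 0 \<mu>) = UNIV"
proof -
  define \<Lambda> where "\<Lambda> = lattice_of_basis B"
  define \<mu> where "\<mu> = successive_minimum \<Lambda> 1"
  have "CARD('n) \<ge> 1" by (simp add: Suc_leI)
  then have one: "1 \<in> {1..CARD('n)}" and top: "CARD('n) \<in> {1..CARD('n)}"
    by auto
  have n: "successive_minimum \<Lambda> (CARD('n)) = \<mu>"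
    using assms(2)[unfolded well_rounded_def, THEN bspec, OF top] unfolding \<Lambda>_def \<mu>_def .
  have sub: "\<Lambda> \<inter> cball 0 \<mu> \<subseteq> insert 0 (\<Lambda> \<inter> sphere 0 \<mu>)"
  proof
    fix x assume x: "x \<in> \<Lambda> \<inter> cball 0 \<mu>"
    show "x \<in> insert 0 (\<Lambda> \<inter> sphere 0 \<mu>)"
    proof (cases "x = 0")
      case False
      then have "1 = dim {x}" by simp
      also have "\<dots> \<le> dim (\<Lambda> \<inter> cball 0 (norm x))"
        using x by (intro dim_subset) auto
      finally have "\<mu> \<le> norm x"
        using successive_minimum_props(3)[OF assms(1) one, of "norm x"] False
        unfolding \<mu>_def \<Lambda>_def by simp
      with x show ?thesis by auto
    qed simp
  qed
  have "CARD('n) \<le> dim (\<Lambda> \<inter> cball 0 \<mu>)"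
    using successive_minimum_props(2)[OF assms(1) top] n unfolding \<Lambda>_def by simp
  also have "\<dots> \<le> dim (insert 0 (\<Lambda> \<inter> sphere 0 \<mu>))"
    using sub by (rule dim_subset)
  also have "\<dots> = dim (\<Lambda> \<inter> sphere 0 \<mu>)"
    by (metis dim_span span_insert_0)
  finally have "dim (\<Lambda> \<inter> sphere 0 \<mu>) = DIM(real ^ 'n)"
    using dim_subset_UNIV[of "\<Lambda> \<inter> sphere 0 \<mu>"] by simp
  then have "span (\<Lambda> \<inter> sphere 0 \<mu>) = UNIV"
    by (simp only: dim_eq_full)
  then show thesis
    unfolding \<Lambda>_def by (rule that)
qed

section \<open>Separating norms by the commutant\<close>

lemma inner_perm_act_invariant:
  assumes "\<tau> permutes UNIV" and "perm_act \<tau> u = u"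
  shows "u \<bullet> perm_act \<tau> x = u \<bullet> x"
proof -
  have u: "u $ \<tau> i = u $ i" for i
    using arg_cong[OF assms(2), of "\<lambda>v. v $ i"] by (simp add: perm_act_def)
  have "u \<bullet> perm_act \<tau> x = (\<Sum>i\<in>UNIV. u $ \<tau> i * x $ \<tau> i)"
    by (simp add: inner_vec_def perm_act_def u)
  also have "\<dots> = (\<Sum>i\<in>UNIV. u $ i * x $ i)"
    using sum.permute[OF assms(1), of "\<lambda>i. u $ i * x $ i"] by (simp add: o_def)
  finally show ?thesis by (simp add: inner_vec_def)
qed

text \<open>The product of the column \<open>w\<close> and the row \<open>u\<close> absorbs the
  permutation matrix on both sides, as \<open>w\<close> is fixed and the functional \<open>u\<close>
  is invariant.\<close>

lemma rank_one_in_commutant: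
  assumes "\<tau> permutes UNIV" and "perm_act \<tau> u = u" and "perm_act \<tau> w = w"
  shows "(\<chi> i j. w $ i * u $ j) \<in> commutant (perm_mat \<tau>)"
    and "(\<chi> i j. w $ i * u $ j) *v x = (u \<bullet> x) *\<^sub>R w"
proof -
  let ?E = "\<chi> i j. w $ i * u $ j"
  show E: "?E *v x = (u \<bullet> x) *\<^sub>R w" for x
    by (simp add: matrix_vector_mult_def vec_eq_iff inner_vec_def sum_distrib_left mult_ac)
  have scale: "perm_act \<tau> (c *\<^sub>R w) = c *\<^sub>R w" for c
    using assms(3) by (simp add: perm_act_def vec_eq_iff)
  have "(perm_mat \<tau> ** ?E) *v x = (?E ** perm_mat \<tau>) *v x" for x
    by (simp add: matrix_vector_mul_assoc[symmetric] E perm_mat_mult_vec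
        scale inner_perm_act_invariant[OF assms(1,2)])
  then show "?E \<in> commutant (perm_mat \<tau>)"
    unfolding commutant_def by (simp add: matrix_eq)
qed

lemma mat_1_in_commutant: "mat 1 \<in> commutant P"
  by (simp add: commutant_def)

text \<open>Otherwise \<open>(u \<bullet> v) * (w \<bullet> v)\<close> and
  \<open>(u \<bullet> v)\<^sup>2\<close> are constant on \<open>X\<close>. Then the pair of inner
  products with \<open>u\<close> and \<open>w\<close> is determined up to a common sign, so a
  nontrivial combination of \<open>u\<close> and \<open>w\<close> is orthogonal to the spanning set
  \<open>X\<close>, against their independence.\<close>

lemma commutant_separates_norms:
  fixes \<tau> :: "'n::finite \<Rightarrow> 'n"
  assumes \<tau>: "\<tau> permutes UNIV" and S: "S \<noteq> {}" "S \<noteq> UNIV" "\<And>i. \<tau> i \<in> S \<longleftrightarrow> i \<in> S"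
    and X: "span X = UNIV"
  obtains v v' C where "v \<in> X" "v' \<in> X" "C \<in> commutant (perm_mat \<tau>)" "norm (C *v v) \<noteq> norm (C *v v')"
proof (rule ccontr)
  assume "\<not> thesis"
  with that have same: "norm (C *v v) = norm (C *v v')"
    if "v \<in> X" "v' \<in> X" "C \<in> commutant (perm_mat \<tau>)" for v v' C
    using \<open>v \<in> X\<close> \<open>v' \<in> X\<close> \<open>C \<in> commutant (perm_mat \<tau>)\<close> by metis
  define u :: "real ^ 'n" where "u = (\<chi> i. if i \<in> S then 1 else 0)"
  define w :: "real ^ 'n" where "w = (\<chi> i. if i \<in> S then 0 else 1)"
  have uw: "perm_act \<tau> u = u" "perm_act \<tau> w = w"
    using S(3) by (simp_all add: perm_act_def u_def w_def vec_eq_iff)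
  obtain p q where p: "p \<in> S" and q: "q \<notin> S" using S(1,2) by blast
  have "u $ p = 1" "w $ q = 1" "u $ q = 0" "w $ p = 0" using p q by (simp_all add: u_def w_def)
  then have "u \<noteq> 0" "w \<noteq> 0" by auto
  define E where "E = (\<chi> i j. w $ i * u $ j)"
  have E: "E \<in> commutant (perm_mat \<tau>)" "\<And>x. E *v x = (u \<bullet> x) *\<^sub>R w"
    unfolding E_def using rank_one_in_commutant[OF \<tau> uw] by blast+
  have plus: "mat 1 + E \<in> commutant (perm_mat \<tau>)" and minus: "mat 1 - E \<in> commutant (perm_mat \<tau>)"
    using subspace_commutant E(1) mat_1_in_commutant by (blast intro: subspace_add subspace_diff)+
  \<comment> \<open>Given equal norms of the vectors, the difference of the two expansions isolates
    the mixed product and their sum the square.\<close>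
  have norm_plus: "(norm ((mat 1 + E) *v x))\<^sup>2 =
      (norm x)\<^sup>2 + 2 * ((u \<bullet> x) * (w \<bullet> x)) + (u \<bullet> x)\<^sup>2 * (norm w)\<^sup>2" for x
    unfolding power2_norm_eq_inner
    by (simp add: matrix_vector_mult_add_rdistrib E(2) inner_add_left inner_add_right
        inner_commute[of x w] power2_eq_square algebra_simps)
  have norm_minus: "(norm ((mat 1 - E) *v x))\<^sup>2 =
      (norm x)\<^sup>2 - 2 * ((u \<bullet> x) * (w \<bullet> x)) + (u \<bullet> x)\<^sup>2 * (norm w)\<^sup>2" for x
    unfolding power2_norm_eq_inner
    by (simp add: matrix_vector_mult_diff_rdistrib E(2) inner_diff_left inner_diff_right
        inner_commute[of x w] power2_eq_square algebra_simps)
  have prod: "(u \<bullet> v) * (w \<bullet> v) = (u \<bullet> v') * (w \<bullet> v')" and square: "(u \<bullet> v)\<^sup>2 = (u \<bullet> v')\<^sup>2"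
    if v: "v \<in> X" "v' \<in> X" for v v'
  proof -
    have 1: "norm v = norm v'" using same[OF v mat_1_in_commutant] by simp
    note 2 = norm_plus[of v, unfolded same[OF v plus] norm_plus 1]
    note 3 = norm_minus[of v, unfolded same[OF v minus] norm_minus 1]
    show "(u \<bullet> v) * (w \<bullet> v) = (u \<bullet> v') * (w \<bullet> v')" using 2 3 by linarith
    have "(u \<bullet> v)\<^sup>2 * (norm w)\<^sup>2 = (u \<bullet> v')\<^sup>2 * (norm w)\<^sup>2" using 2 3 by linarith
    then show "(u \<bullet> v)\<^sup>2 = (u \<bullet> v')\<^sup>2" using \<open>w \<noteq> 0\<close> by simp
  qed
  have orth: "z = 0" if z: "\<And>v. v \<in> X \<Longrightarrow> z \<bullet> v = 0" for z
    using orthogonal_to_span[of z X z] X z by (simp add: orthogonal_def)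
  then obtain v0 where v0: "v0 \<in> X" "u \<bullet> v0 \<noteq> 0" using \<open>u \<noteq> 0\<close> by blast
  define a where "a = u \<bullet> v0"
  define b where "b = w \<bullet> v0"
  \<comment> \<open>This combination is chosen to kill \<open>(a, b)\<close>, hence also
    \<open>(-a, -b)\<close>.\<close>
  have "b *\<^sub>R u - a *\<^sub>R w = 0"
  proof (rule orth)
    fix v assume v: "v \<in> X"
    have 1: "(u \<bullet> v) * (w \<bullet> v) = a * b" and 2: "(u \<bullet> v)\<^sup>2 = a\<^sup>2"
      using prod[OF v v0(1)] square[OF v v0(1)] by (simp_all add: a_def b_def)
    have "u \<bullet> v = a \<or> u \<bullet> v = - a" using 2 by (simp add: power2_eq_iff)
    then show "(b *\<^sub>R u - a *\<^sub>R w) \<bullet> v = 0"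
    proof
      assume "u \<bullet> v = a"
      with 1 show ?thesis
        using v0(2) by (simp add: a_def[symmetric] inner_diff_left)
    next
      assume "u \<bullet> v = - a"
      with 1 have "a * b + a * (w \<bullet> v) = 0" by simp
      with \<open>u \<bullet> v = - a\<close> show ?thesis by (simp add: inner_diff_left algebra_simps)
    qed
  qed
  from arg_cong[OF this, of "\<lambda>z. z $ q"] have "a = 0"
    using \<open>w $ q = 1\<close> \<open>u $ q = 0\<close> by simp
  then show False using v0(2) by (simp add: a_def)
qed

section \<open>The codimension of well-rounded lattices\<close>

text \<open>The difference of the squared norms is a quadratic form in the matrix, and the given
  \<open>C\<close> is a direction in which it does not vanish.\<close>

lemma hausdorff_null_equal_norms:
  fixes V :: "(real ^ 'n ^ 'm) set"
  assumes "subspace V" and "C \<in> V" and "norm (C *v v) \<noteq> norm (C *v v')"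
    and "real (dim V) - 1/2 < s"
  shows "hausdorff_null s {C \<in> V. norm (C *v v) = norm (C *v v')}"
proof -
  define \<beta> :: "real ^ 'n ^ 'm \<Rightarrow> real ^ 'n ^ 'm \<Rightarrow> real"
    where "\<beta> = (\<lambda>X Y. (X *v v) \<bullet> (Y *v v) - (X *v v') \<bullet> (Y *v v'))"
  have \<beta>: "\<beta> X X = (norm (X *v v))\<^sup>2 - (norm (X *v v'))\<^sup>2" for X
    by (simp add: \<beta>_def power2_norm_eq_inner)
  have "bilinear \<beta>"
    unfolding bilinear_def \<beta>_def
    by (intro conjI allI linearI)
      (simp_all add: matrix_vector_mult_add_rdistrib scaleR_matrix_vector_assoc[symmetric]
        inner_add_left inner_add_right right_diff_distrib)
  then have "bounded_bilinear \<beta>" by (simp only: bilinear_conv_bounded_bilinear)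
  moreover have "\<beta> C C \<noteq> 0" using assms(3) by (simp add: \<beta>)
  ultimately have "hausdorff_null s {X \<in> V. \<beta> X X = 0}"
    using assms by (intro hausdorff_null_quadric)
  then show ?thesis by (simp add: \<beta>)
qed

lemma open_invertible: "open {A :: real ^ 'n ^ 'n. invertible A}"
proof -
  have "continuous_on UNIV (det :: real ^ 'n ^ 'n \<Rightarrow> real)"
    unfolding det_def by (intro continuous_intros)
  then have "open (det -` (- {0}) :: (real ^ 'n ^ 'n) set)"
    by (intro open_vimage) auto
  then show ?thesis by (simp add: vimage_def invertible_det_nz)
qed

text \<open>Invertibility is an open condition, so a small ball around the identity in the commutant
  consists of basis matrices of invariant lattices.\<close>

lemma invariant_lattice_dim_ge:
  fixes \<tau> :: "'n::finite \<Rightarrow> 'n"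
  assumes "\<tau> permutes UNIV"
  shows "ereal (real (dim (commutant (perm_mat \<tau>)))) \<le> lattice_dim (invariant_lattices \<tau>)"
    and "dim (commutant (perm_mat \<tau>)) > 0"
proof -
  let ?V = "commutant (perm_mat \<tau>)"
  have "mat 1 \<noteq> (0 :: real ^ 'n ^ 'n)"
    by (auto simp: mat_def vec_eq_iff)
  then have "1 \<le> dim {mat 1 :: real ^ 'n ^ 'n}" by simp
  also have "\<dots> \<le> dim ?V" by (intro dim_subset) (simp add: mat_1_in_commutant)
  finally show pos: "dim ?V > 0" by simp
  have "invertible (mat 1 :: real ^ 'n ^ 'n)" by (simp add: invertible_def)
  then obtain \<rho> where \<rho>: "\<rho> > 0" "cball (mat 1 :: real ^ 'n ^ 'n) \<rho> \<subseteq> {A. invertible A}"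
    using open_invertible unfolding open_contains_cball by blast
  have "?V \<inter> cball (mat 1) \<rho> \<subseteq> basis_matrices (invariant_lattices \<tau>)"
  proof
    fix C assume "C \<in> ?V \<inter> cball (mat 1) \<rho>"
    then have "invertible C" "C \<in> ?V" using \<rho>(2) by auto
    then show "C \<in> basis_matrices (invariant_lattices \<tau>)"
      using invariant_if_commutant[OF assms]
      by (auto simp: basis_matrices_def invariant_lattices_def full_rank_lattice_def)
  qed
  then show "ereal (real (dim ?V)) \<le> lattice_dim (invariant_lattices \<tau>)"
    unfolding lattice_dim_def
    by (rule hausdorff_dim_ge[OF subspace_commutant mat_1_in_commutant \<rho>(1) _ pos])
qed

lemma well_rounded_invariant_lattice_dim_le:
  fixes \<tau> :: "'n::finite \<Rightarrow> 'n"
  assumes \<tau>: "\<tau> permutes UNIV" and "\<not> full_cycle \<tau>"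
    and s: "real (dim (commutant (perm_mat \<tau>))) - 1/2 < s" "s > 0"
  shows "lattice_dim {\<Lambda> \<in> invariant_lattices \<tau>. well_rounded \<Lambda>} \<le> ereal s"
proof -
  obtain S where S: "S \<noteq> {}" "S \<noteq> UNIV" "\<And>i. \<tau> i \<in> S \<longleftrightarrow> i \<in> S"
    by (rule not_full_cycle_invariant_set[OF assms(1,2)]) blast
  define P where "P = perm_mat \<tau>"
  define V where "V = commutant P"
  \<comment> \<open>One reference solution for each \<open>M\<close>. For an \<open>M\<close>
    without invertible solution it is an arbitrary matrix, which still gives a linear map and hence
    a null image.\<close>
  define B\<^sub>0 :: "real ^ 'n ^ 'n \<Rightarrow> real ^ 'n ^ 'n" where "B\<^sub>0 = (\<lambda>M. SOME B. invertible B \<and> P ** B = B ** M)"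
  define T where "T = (\<lambda>(M, z, z'). {C \<in> V. norm (C *v (B\<^sub>0 M *v z)) = norm (C *v (B\<^sub>0 M *v z'))})"
  define I :: "((real ^ 'n ^ 'n) \<times> (real ^ 'n) \<times> (real ^ 'n)) set"
    where "I = {(M, z, z'). (\<forall>i j. M $ i $ j \<in> \<int>) \<and> (\<forall>i. z $ i \<in> \<int>) \<and> (\<forall>i. z' $ i \<in> \<int>) \<and>
      (\<exists>C\<in>V. norm (C *v (B\<^sub>0 M *v z)) \<noteq> norm (C *v (B\<^sub>0 M *v z')))}"
  have "countable I"
  proof (rule countable_subset)
    let ?Z = "{z :: real ^ 'n. \<forall>i. z $ i \<in> \<int>}"
    have Z: "countable ?Z"
      by (rule countable_vector) (rule countable_int)
    have "countable {M :: real ^ 'n ^ 'n. \<forall>i. M $ i \<in> ?Z}"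
      by (rule countable_vector) (rule Z)
    with Z show "countable ({M :: real ^ 'n ^ 'n. \<forall>i. M $ i \<in> ?Z} \<times> ?Z \<times> ?Z)"
      by (intro countable_SIGMA)
    show "I \<subseteq> {M :: real ^ 'n ^ 'n. \<forall>i. M $ i \<in> ?Z} \<times> ?Z \<times> ?Z"
      by (auto simp: I_def)
  qed
  have null: "hausdorff_null s (\<Union>i\<in>I. (\<lambda>C. C ** B\<^sub>0 (fst i)) ` T i)"
  proof (rule hausdorff_null_UN[OF \<open>countable I\<close>])
    fix i assume "i \<in> I"
    then obtain M z z' C where i: "i = (M, z, z')" and C: "C \<in> V"
      "norm (C *v (B\<^sub>0 M *v z)) \<noteq> norm (C *v (B\<^sub>0 M *v z'))"
      by (auto simp: I_def)
    have "hausdorff_null s (T i)"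
      unfolding T_def i prod.case
      by (rule hausdorff_null_equal_norms[OF _ C])
        (use s(1) in \<open>simp_all add: V_def P_def subspace_commutant\<close>)
    then show "hausdorff_null s ((\<lambda>C. C ** B\<^sub>0 (fst i)) ` T i)"
      using s(2) linear_matrix_mult_right by (rule hausdorff_null_linear_image)
  qed
  have "basis_matrices {\<Lambda> \<in> invariant_lattices \<tau>. well_rounded \<Lambda>}
      \<subseteq> (\<Union>i\<in>I. (\<lambda>C. C ** B\<^sub>0 (fst i)) ` T i)"
  proof
    fix B assume "B \<in> basis_matrices {\<Lambda> \<in> invariant_lattices \<tau>. well_rounded \<Lambda>}"
    then have B: "invertible B" "perm_act \<tau> ` lattice_of_basis B = lattice_of_basis B"
      "well_rounded (lattice_of_basis B)"
      by (auto simp: basis_matrices_def invariant_lattices_def)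
    obtain M where M: "\<And>i j. M $ i $ j \<in> \<int>" "P ** B = B ** M"
      using invariant_imp_integral_conjugate[OF B(2)] unfolding P_def by blast
    have "\<exists>B. invertible B \<and> P ** B = B ** M" using B(1) M(2) by blast
    then have B0: "invertible (B\<^sub>0 M)" "P ** B\<^sub>0 M = B\<^sub>0 M ** M"
      unfolding B\<^sub>0_def by (rule someI2_ex, simp)+
    define C where "C = B ** matrix_inv (B\<^sub>0 M)"
    have C: "C \<in> V" "C ** B\<^sub>0 M = B"
      unfolding C_def V_def by (rule commutant_conjugate[OF M(2) B0(2,1)])+
    obtain \<mu> where \<mu>: "span (lattice_of_basis B \<inter> sphere 0 \<mu>) = UNIV"
      using well_rounded_imp_spanning_sphere[OF B(1,3)] by blast
    \<comment> \<open>\<open>G\<close> moves the minimal vectors \<open>B z\<close> to the vectors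
      \<open>B\<^sub>0 M z\<close>, which depend on \<open>M\<close> and \<open>z\<close> alone and
      leave countably many conditions. Being onto, it preserves spanning.\<close>
    define G where "G = B\<^sub>0 M ** matrix_inv B"
    have G: "G *v (B *v z) = B\<^sub>0 M *v z" for z
      by (simp add: G_def matrix_vector_mul_assoc matrix_mul_assoc[symmetric] matrix_inv_inverse(2)[OF B(1)])
    have "surj ((*v) G)"
    proof (rule surjI)
      fix x
      have "x = B\<^sub>0 M *v (matrix_inv (B\<^sub>0 M) *v x)"
        by (simp add: matrix_vector_mul_assoc matrix_inv_inverse(1)[OF B0(1)])
      then show "G *v (B *v (matrix_inv (B\<^sub>0 M) *v x)) = x" by (simp add: G)
    qed
    then have "span ((*v) G ` (lattice_of_basis B \<inter> sphere 0 \<mu>)) = UNIV"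
      by (simp add: linear_span_image \<mu>)
    then obtain v v' C' where v: "v \<in> (*v) G ` (lattice_of_basis B \<inter> sphere 0 \<mu>)"
        "v' \<in> (*v) G ` (lattice_of_basis B \<inter> sphere 0 \<mu>)"
      and C': "C' \<in> V" "norm (C' *v v) \<noteq> norm (C' *v v')"
      using commutant_separates_norms[OF \<tau> S] unfolding V_def P_def by blast
    obtain z where z: "v = B\<^sub>0 M *v z" "\<forall>i. z $ i \<in> \<int>" "norm (B *v z) = \<mu>"
      using v(1) by (auto simp: lattice_of_basis_def G)
    obtain z' where z': "v' = B\<^sub>0 M *v z'" "\<forall>i. z' $ i \<in> \<int>" "norm (B *v z') = \<mu>"
      using v(2) by (auto simp: lattice_of_basis_def G)
    have "(M, z, z') \<in> I"
      using M(1) z(1,2) z'(1,2) C' by (auto simp: I_def)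
    \<comment> \<open>\<open>C\<close> maps the two reference vectors back to \<open>B z\<close> and
      \<open>B z'\<close>, both of norm \<open>\<mu>\<close>.\<close>
    moreover have "C \<in> T (M, z, z')"
      using C z(3) z'(3) by (simp add: T_def matrix_vector_mul_assoc)
    ultimately show "B \<in> (\<Union>i\<in>I. (\<lambda>C. C ** B\<^sub>0 (fst i)) ` T i)"
      using C(2) by (intro UN_I[of "(M, z, z')"] image_eqI[of _ _ C]) auto
  qed
  then have "hausdorff_null s (basis_matrices {\<Lambda> \<in> invariant_lattices \<tau>. well_rounded \<Lambda>})"
    by (rule hausdorff_null_subset[OF null])
  then show ?thesis
    unfolding lattice_dim_def by (rule hausdorff_dim_le[OF s(2)])
qed

theorem theorem1p2:
  fixes \<tau> :: "'n::finite \<Rightarrow> 'n"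
  assumes "CARD('n) \<ge> 2"
    and "\<tau> permutes UNIV"
    and "\<not> full_cycle \<tau>"
  shows "0 < lattice_codim {\<Lambda> \<in> invariant_lattices \<tau>. well_rounded \<Lambda>} (invariant_lattices \<tau>)"
proof -
  let ?L = "invariant_lattices \<tau>" and ?W = "{\<Lambda> \<in> invariant_lattices \<tau>. well_rounded \<Lambda>}"
  define d where "d = real (dim (commutant (perm_mat \<tau>)))"
  have d: "ereal d \<le> lattice_dim ?L" "d \<ge> 1"
    using invariant_lattice_dim_ge[OF assms(2)] by (simp_all add: d_def)
  \<comment> \<open>Any exponent strictly between \<open>d - 1/2\<close> and \<open>d\<close> would
    do; this one is positive because \<open>d \<ge> 1\<close>.\<close>
  have "lattice_dim ?W \<le> ereal (d - 1/4)"
    using d(2) by (intro well_rounded_invariant_lattice_dim_le assms) (simp_all add: d_def)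
  \<comment> \<open>Finiteness of the smaller dimension makes the extended real difference
    meaningful, whether or not the larger one is finite.\<close>
  moreover have "0 \<le> lattice_dim ?W"
    unfolding lattice_dim_def by (rule hausdorff_dim_nonneg)
  ultimately obtain w where w: "lattice_dim ?W = ereal w" "w \<le> d - 1/4"
    by (cases "lattice_dim ?W") auto
  show ?thesis
    unfolding lattice_codim_def using d(1) w by (cases "lattice_dim ?L") auto
qed

end
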